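(* Let $b>1$ be fixed, let $p=b\log N/N$, and consider majority dynamics with independently resampled update graphs $G_t\sim\mathbb G(N,p)$ started from a deterministic initial configuration $y_0\in\{\pm1\}^{[N]}$ with initial advantage $\Delta_0=|B_0|-|R_0|$. Let $$r_*=\frac12\Bigl(1-\frac{\sqrt{2b-1}}{b}\Bigr),\qquad K_2^{\mathrm{ER}}(b)=\frac1{\sqrt b}\,\Phi^{-1}(1-r_* ).$$ Then the following hold for all sufficiently large $N$. (i) (Two days.) Fix $K>K_2^{\mathrm{ER}}(b)$. If $\Delta_0\ge K N/\sqrt{\log N}$, then there exists $\xi=\xi(b,K)>0$ (depending only on $b$ and $K$) such that $$\mathbb P(R_2=\emptyset\mid y_0)\ge 1-2\exp\bigl(-(\log N)^2\bigr)-2N^{-\xi}.$$ (ii) (One day.) Fix $0<r<r_*$. If $\Delta_0\ge(1-2r)N$, then there exists $\xi=\xi(b,r)>0$ (depending only on $b$ and $r$) such that $$\mathbb P(R_1=\emptyset\mid y_0)\ge 1-2N^{-\xi}.$$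
   Context: Majority dynamics with resampling: the vertex set is $[N]=\{1,\dots,N\}$; $y_t\in\{\pm1\}^{[N]}$ is the configuration at day $t$ ($+1$ = blue, $-1$ = red), $B_t=\{v:y_t(v)=+1\}$, $R_t=\{v:y_t(v)=-1\}$, $\Delta_t=|B_t|-|R_t|$. The graphs $G_1,G_2,\dots$ are i.i.d. Erdős–Rényi graphs $\mathbb G(N,p)$ on $[N]$ (each edge present independently with probability $p$), independent of the fixed initial configuration $y_0$. At day $t+1$ all vertices update synchronously: if in $G_{t+1}$ the vertex $v$ has strictly more neighbors in $B_t$ than in $R_t$ then $y_{t+1}(v)=+1$; if strictly fewer then $y_{t+1}(v)=-1$; if equal then $y_{t+1}(v)=y_t(v)$. $\Phi$ is the standard normal distribution function and $\Phi^{-1}$ its inverse. Logarithms are natural. "For all sufficiently large $N$" is with thresholds depending only on the fixed parameters ($b,K$ in (i); $b,r$ in (ii)). The number $r_*$ is the unique solution in $(0,1/2)$ of $b(\sqrt{1-r}-\sqrt r)^2=1$. *)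

theory Defs
  imports "HOL-Probability.Probability" "HOL-Probability.Product_PMF"
begin

section \<open>Erdos--Renyi graphs\<close>

text \<open>A simple graph on $\{1,\dots,N\}$ is given by its edge set, a set of two-element
  subsets of the vertex set.\<close>

definition all_edges :: "nat \<Rightarrow> nat set set" where
  "all_edges N = {e. e \<subseteq> {1..N} \<and> card e = 2}"

text \<open>The function \<^const>\<open>bernoulli_pmf\<close> truncates its parameter to the unit interval, so
  parameters outside it are harmless.\<close>

definition erdos_renyi :: "nat \<Rightarrow> real \<Rightarrow> nat set set pmf" where
  "erdos_renyi N p =
     map_pmf (\<lambda>f. {e \<in> all_edges N. f e})
       (Pi_pmf (all_edges N) False (\<lambda>_. bernoulli_pmf p))"

text \<open>The law of the i.i.d. sequence $G_1, G_2, \dots$ on its canonical product space.\<close>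

definition graph_sequence :: "nat \<Rightarrow> real \<Rightarrow> (nat \<Rightarrow> nat set set) measure" where
  "graph_sequence N p = (\<Pi>\<^sub>M t\<in>{1..}. measure_pmf (erdos_renyi N p))"


section \<open>Majority dynamics\<close>

text \<open>Configurations assign $+1$ (blue) or $-1$ (red) to each vertex; only their values on
  $\{1,\dots,N\}$ are relevant.\<close>

definition blue :: "nat \<Rightarrow> (nat \<Rightarrow> int) \<Rightarrow> nat set" where
  "blue N y = {v \<in> {1..N}. y v = 1}"

definition red :: "nat \<Rightarrow> (nat \<Rightarrow> int) \<Rightarrow> nat set" where
  "red N y = {v \<in> {1..N}. y v = -1}"

definition advantage :: "nat \<Rightarrow> (nat \<Rightarrow> int) \<Rightarrow> int" where
  "advantage N y = int (card (blue N y)) - int (card (red N y))"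

definition neighbors :: "nat set set \<Rightarrow> nat \<Rightarrow> nat set" where
  "neighbors G v = {w. {v, w} \<in> G}"

definition majority_step ::
    "nat \<Rightarrow> nat set set \<Rightarrow> (nat \<Rightarrow> int) \<Rightarrow> nat \<Rightarrow> int" where
  "majority_step N G y v =
     (if card (neighbors G v \<inter> blue N y) > card (neighbors G v \<inter> red N y) then 1
      else if card (neighbors G v \<inter> blue N y) < card (neighbors G v \<inter> red N y) then -1
      else y v)"

primrec configuration ::
    "nat \<Rightarrow> (nat \<Rightarrow> int) \<Rightarrow> (nat \<Rightarrow> nat set set) \<Rightarrow> nat \<Rightarrow> nat \<Rightarrow> int" where
  "configuration N y\<^sub>0 G 0 = y\<^sub>0"
| "configuration N y\<^sub>0 G (Suc t) = majority_step N (G (Suc t)) (configuration N y\<^sub>0 G t)"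

text \<open>The initial configuration is deterministic, so conditioning on it amounts to using it
  as a parameter.\<close>

definition prob_no_red :: "nat \<Rightarrow> real \<Rightarrow> (nat \<Rightarrow> int) \<Rightarrow> nat \<Rightarrow> real" where
  "prob_no_red N p y\<^sub>0 t =
     \<P>(G in graph_sequence N p. red N (configuration N y\<^sub>0 G t) = {})"


section \<open>Critical constants\<close>

definition r_star :: "real \<Rightarrow> real" where
  "r_star b = (1 / 2) * (1 - sqrt (2 * b - 1) / b)"

lemma r_star_unique:
  fixes b r :: real
  assumes "b > 1"
  shows "0 < r \<and> r < 1 / 2 \<and> b * (sqrt (1 - r) - sqrt r)\<^sup>2 = 1 \<longleftrightarrow> r = r_star b"
proof -
  define s where "s = sqrt (2 * b - 1)"
  have s2: "s\<^sup>2 = 2 * b - 1" and s0: "s > 0"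
    using assms by (auto simp: s_def)
  have "(b - 1)\<^sup>2 > 0" using assms by simp
  hence "s\<^sup>2 < b\<^sup>2" unfolding s2 by (simp add: power2_diff)
  hence sb: "s < b" using assms by (intro power2_less_imp_less[of s b]) auto
  have r_star: "r_star b = (1 - s / b) / 2" by (simp add: r_star_def s_def)
  have range: "0 < r_star b" "r_star b < 1 / 2"
    using sb s0 assms by (simp_all add: r_star)
  have eq: "b * (sqrt (1 - x) - sqrt x)\<^sup>2 = 1 \<longleftrightarrow> x = r_star b"
    if x: "0 < x" "x < 1 / 2" for x
  proof -
    define q where "q = sqrt (x * (1 - x))"
    have q0: "q \<ge> 0" and q2: "q\<^sup>2 = x * (1 - x)" using x by (auto simp: q_def)
    have sq: "(sqrt (1 - x) - sqrt x)\<^sup>2 = 1 - 2 * q"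
      using x by (simp add: power2_diff q_def real_sqrt_mult)
    have "b * (1 - 2 * q) = 1 \<longleftrightarrow> 2 * b * q = b - 1"
      by (auto simp: right_diff_distrib)
    also have "\<dots> \<longleftrightarrow> (2 * b * q)\<^sup>2 = (b - 1)\<^sup>2"
      using q0 assms by (intro power2_eq_iff_nonneg [symmetric]) auto
    also have "\<dots> \<longleftrightarrow> (b * (1 - 2 * x))\<^sup>2 = s\<^sup>2"
    proof -
      have "(b * (1 - 2 * x))\<^sup>2 - s\<^sup>2 = (b - 1)\<^sup>2 - (2 * b * q)\<^sup>2"
        unfolding s2 power_mult_distrib q2 by (simp add: power2_eq_square algebra_simps)
      thus ?thesis by linarith
    qed
    also have "\<dots> \<longleftrightarrow> b * (1 - 2 * x) = s"
      using x s0 assms by (intro power2_eq_iff_nonneg) auto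
    also have "\<dots> \<longleftrightarrow> 1 - 2 * x = s / b"
      using assms by (simp add: eq_divide_eq mult.commute)
    also have "\<dots> \<longleftrightarrow> x = r_star b"
      by (auto simp: r_star)
    finally show ?thesis by (simp add: sq)
  qed
  show ?thesis using eq range by blast
qed

definition std_normal_cdf :: "real \<Rightarrow> real" where
  "std_normal_cdf = cdf std_normal_distribution"

text \<open>The standard normal distribution function is a bijection from the reals onto the open
  unit interval, so \<^const>\<open>inv\<close> yields the quantile function there.\<close>

definition K2_ER :: "real \<Rightarrow> real" where
  "K2_ER b = (1 / sqrt b) * inv std_normal_cdf (1 - r_star b)"

end

(* Let X and Y count the blue and the red neighbours of a vertex. If a fraction r of the vertices
   is red, the Chernoff bound gives P(X <= Y) <= N^(-b (sqrt(1-r) - sqrt r)^2 + o(1)); for r < r_star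
   the exponent is below -1 and a union bound over the vertices settles one day.

   For two days, the number of red neighbours only matters through an upper bound, since moving
   vertices from blue to red increases P(X <= Y). In the extremal case (X - Y) / sqrt(b log N) is
   asymptotically normal with mean K sqrt b and variance 1, by convergence of characteristic
   functions, so a vertex is red on day 1 with probability at most q < r_star. The events of two
   vertices share only the edge between them, so their covariance is at most 4p, and Chebyshev's
   inequality shows that at most (q + delta) N < r_star N vertices are red, except with probability
   O(log N / N). This can be absorbed into the term N^(-xi), so no exponential concentration
   inequality is needed. The one-day result applied to the fresh graph of day 2 concludes. *)

theory Submission
  imports Defs "HOL-Real_Asymp.Real_Asymp"
begin

section \<open>Binomial counts and weakly dependent events\<close>

text \<open>Independence turns the sum over the product of the supports into a product of sums. The
  codomain is kept general because the Chernoff bound uses real values and the characteristic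
  functions use complex ones.\<close>

lemma expectation_pair_pmf_mult:
  fixes f :: "'a \<Rightarrow> 'c::{real_normed_field, banach, second_countable_topology}"
  assumes "finite (set_pmf M)" "finite (set_pmf M')"
  shows "measure_pmf.expectation (pair_pmf M M') (\<lambda>z. f (fst z) * g (snd z)) =
         measure_pmf.expectation M f * measure_pmf.expectation M' g"
proof -
  have "measure_pmf.expectation (pair_pmf M M') (\<lambda>z. f (fst z) * g (snd z)) =
        (\<Sum>z\<in>set_pmf M \<times> set_pmf M'. pmf (pair_pmf M M') z *\<^sub>R (f (fst z) * g (snd z)))"
    using assms by (intro integral_measure_pmf) auto
  also have "\<dots> = (\<Sum>z\<in>set_pmf M \<times> set_pmf M'. (pmf M (fst z) *\<^sub>R f (fst z)) * (pmf M' (snd z) *\<^sub>R g (snd z)))"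
    by (intro sum.cong) (auto simp: pmf_pair)
  also have "\<dots> = (\<Sum>a\<in>set_pmf M. pmf M a *\<^sub>R f a) * (\<Sum>b\<in>set_pmf M'. pmf M' b *\<^sub>R g b)"
    by (subst sum_product, subst sum.cartesian_product) (auto intro: sum.cong)
  also have "\<dots> = measure_pmf.expectation M f * measure_pmf.expectation M' g"
    using assms by (subst (1 2) integral_measure_pmf[symmetric]) auto
  finally show ?thesis .
qed

text \<open>This is the binomial theorem read as a probability generating function. A real
  \<open>z\<close> serves the Chernoff bound, a complex \<open>z\<close> of modulus 1 the
  characteristic function.\<close>

lemma expectation_binomial_pmf_power:
  fixes z :: "'a::{real_normed_field, banach, second_countable_topology}"
  assumes "p \<in> {0..1}"
  shows "measure_pmf.expectation (binomial_pmf n p) (\<lambda>k. z ^ k) = (of_real (1 - p) + of_real p * z) ^ n"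
proof -
  have "(of_real p * z + of_real (1 - p)) ^ n =
        (\<Sum>k\<le>n. (real (n choose k) * p ^ k * (1 - p) ^ (n - k)) *\<^sub>R z ^ k)"
    by (subst binomial_ring)
       (auto intro!: sum.cong simp: scaleR_conv_of_real power_mult_distrib)
  thus ?thesis
    using assms by (simp add: expectation_binomial_pmf' add.commute)
qed

text \<open>Ties are counted although only a red vertex stays red on a tie; this enlarges the event and
  makes one bound serve both colours.\<close>

definition minority_prob :: "nat \<Rightarrow> nat \<Rightarrow> real \<Rightarrow> real" where
  "minority_prob n m p =
     measure_pmf.prob (pair_pmf (binomial_pmf n p) (binomial_pmf m p)) {(i, j). i \<le> j}"

text \<open>For s <= 1 the indicator of i <= j is at most s^(i - j), whose expectation factors into
  two generating functions, and 1 + x <= exp x bounds each of them. The parameter \<open>s\<close>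
  stays free so that it can be optimised later.\<close>

lemma minority_prob_chernoff:
  assumes p: "p \<in> {0..1}" and s: "0 < s" "s \<le> 1"
  shows "minority_prob n m p \<le> exp (p * (real n * (s - 1) + real m * (1 / s - 1)))"
proof -
  let ?M = "pair_pmf (binomial_pmf n p) (binomial_pmf m p)"
  have fin: "finite (set_pmf (binomial_pmf k p))" for k
    using p by auto
  have "minority_prob n m p = measure_pmf.expectation ?M (indicator {(i, j). i \<le> j})"
    by (simp add: minority_prob_def)
  also have "\<dots> \<le> measure_pmf.expectation ?M (\<lambda>z. s ^ fst z * (1 / s) ^ snd z)"
  proof (intro integral_mono integrable_measure_pmf_finite)
    fix z :: "nat \<times> nat"
    have "1 \<le> s ^ i * (1 / s) ^ j" if "i \<le> j" for i j :: nat
    proof -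
      have "s ^ j \<le> s ^ i"
        using s that by (intro power_decreasing) auto
      thus ?thesis
        using s by (simp add: power_divide field_simps)
    qed
    thus "indicator {(i, j). i \<le> j} z \<le> s ^ fst z * (1 / s) ^ snd z"
      using s by (auto simp: indicator_def)
  qed (use fin in auto)
  also have "\<dots> = (1 - p + p * s) ^ n * (1 - p + p * (1 / s)) ^ m"
    using p by (subst expectation_pair_pmf_mult[OF fin fin])
               (simp add: expectation_binomial_pmf_power[where 'a = real])
  also have "\<dots> \<le> exp (p * (s - 1)) ^ n * exp (p * (1 / s - 1)) ^ m"
  proof (intro mult_mono power_mono)
    show "1 - p + p * s \<le> exp (p * (s - 1))" "1 - p + p * (1 / s) \<le> exp (p * (1 / s - 1))"
      using exp_ge_add_one_self[of "p * (s - 1)"] exp_ge_add_one_self[of "p * (1 / s - 1)"]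
      by (simp_all add: algebra_simps)
  qed (use p s in auto)
  also have "\<dots> = exp (p * (real n * (s - 1) + real m * (1 / s - 1)))"
    by (simp add: exp_of_nat_mult[symmetric] mult_exp_exp algebra_simps)
  finally show ?thesis .
qed

section \<open>Weak dependence and the second moment\<close>

lemma prob_Pi_pmf_Int_disjoint:
  assumes fin: "finite A" and disj: "S \<inter> T = {}"
    and X: "\<And>f g. (\<And>x. x \<in> S \<Longrightarrow> f x = g x) \<Longrightarrow> f \<in> X \<longleftrightarrow> g \<in> X"
    and Y: "\<And>f g. (\<And>x. x \<in> T \<Longrightarrow> f x = g x) \<Longrightarrow> f \<in> Y \<longleftrightarrow> g \<in> Y"
  shows "measure_pmf.prob (Pi_pmf A d p) (X \<inter> Y) =
         measure_pmf.prob (Pi_pmf A d p) X * measure_pmf.prob (Pi_pmf A d p) Y"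
proof -
  define P where "P = Pi_pmf (A \<inter> S) d p"
  define Q where "Q = Pi_pmf (A - S) d p"
  \<comment> \<open>\<open>h\<close> glues two independent halves of the coordinates; outside
    \<open>A\<close> the second half supplies the default \<open>d\<close>.\<close>
  define h where "h = (\<lambda>(f, g) x. if x \<in> A \<inter> S then f x else (g x :: 'b))"
  have AQ: "Pi_pmf A d p = map_pmf h (pair_pmf P Q)"
    using Pi_pmf_union[of "A \<inter> S" "A - S" d p] fin
    by (simp add: h_def P_def Q_def Int_Diff_Un Int_Diff_disjoint)
  \<comment> \<open>\<open>S\<close> and \<open>T\<close> may reach outside \<open>A\<close>. There
    all functions in the supports take the value \<open>d\<close>, so \<open>h (f, g)\<close> agrees
    with \<open>f\<close> on all of \<open>S\<close> and with \<open>g\<close> on all of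
    \<open>T\<close>.\<close>
  have outP: "f x = d" if "f \<in> set_pmf P" "x \<notin> A \<inter> S" for f x
    using that set_Pi_pmf_subset[of "A \<inter> S" d p] fin by (auto simp: P_def)
  have outQ: "f x = d" if "f \<in> set_pmf Q" "x \<notin> A - S" for f x
    using that set_Pi_pmf_subset[of "A - S" d p] fin by (auto simp: Q_def)
  have hX: "h (f, g) \<in> X \<longleftrightarrow> f \<in> X" if "f \<in> set_pmf P" "g \<in> set_pmf Q" for f g
    using outP[OF that(1)] outQ[OF that(2)] by (intro X) (auto simp: h_def)
  have hY: "h (f, g) \<in> Y \<longleftrightarrow> g \<in> Y" if "f \<in> set_pmf P" "g \<in> set_pmf Q" for f g
    using outP[OF that(1)] outQ[OF that(2)] disj by (intro Y) (auto simp: h_def)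
  have prod: "measure_pmf.prob (pair_pmf P Q) (h -` Z) = measure_pmf.prob P U * measure_pmf.prob Q V"
    if "\<And>f g. f \<in> set_pmf P \<Longrightarrow> g \<in> set_pmf Q \<Longrightarrow> h (f, g) \<in> Z \<longleftrightarrow> f \<in> U \<and> g \<in> V" for Z U V
  proof -
    have "measure_pmf.prob (pair_pmf P Q) (h -` Z) =
          measure_pmf.prob (pair_pmf P Q) ((U \<inter> set_pmf P) \<times> (V \<inter> set_pmf Q))"
      using that by (intro measure_prob_cong_0) (auto simp: set_pmf_iff pmf_pair)
    also have "\<dots> = measure_pmf.prob P (U \<inter> set_pmf P) * measure_pmf.prob Q (V \<inter> set_pmf Q)"
      by (intro measure_pmf_prob_product) auto
    finally show ?thesis
      by (simp add: measure_Int_set_pmf)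
  qed
  have "measure_pmf.prob (Pi_pmf A d p) (X \<inter> Y) = measure_pmf.prob P X * measure_pmf.prob Q Y"
    unfolding AQ measure_map_pmf by (rule prod) (auto simp: hX hY)
  moreover have "measure_pmf.prob (Pi_pmf A d p) X = measure_pmf.prob P X * measure_pmf.prob Q UNIV"
    unfolding AQ measure_map_pmf by (rule prod) (auto simp: hX hY)
  moreover have "measure_pmf.prob (Pi_pmf A d p) Y = measure_pmf.prob P UNIV * measure_pmf.prob Q Y"
    unfolding AQ measure_map_pmf by (rule prod) (auto simp: hX hY)
  ultimately show ?thesis
    by simp
qed

text \<open>Forcing coordinate \<open>e\<close> to \<open>False\<close> makes the two events independent, and each of the
  probabilities involved changes by at most \<open>p\<close>.\<close>

lemma prob_Pi_pmf_Int_common_coordinate: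
  assumes fin: "finite A" and p: "p \<in> {0..1}" and ST: "S \<inter> T \<subseteq> {e}"
    and X: "\<And>f g. (\<And>x. x \<in> S \<Longrightarrow> f x = g x) \<Longrightarrow> f \<in> X \<longleftrightarrow> g \<in> X"
    and Y: "\<And>f g. (\<And>x. x \<in> T \<Longrightarrow> f x = g x) \<Longrightarrow> f \<in> Y \<longleftrightarrow> g \<in> Y"
  defines "M \<equiv> Pi_pmf A False (\<lambda>_. bernoulli_pmf p)"
  shows "measure_pmf.prob M (X \<inter> Y) \<le> measure_pmf.prob M X * measure_pmf.prob M Y + 4 * p"
proof -
  define X' where "X' = {f. f(e := False) \<in> X}"
  define Y' where "Y' = {f. f(e := False) \<in> Y}"
  define E where "E = {f. f e}"
  have "measure_pmf.prob M E = measure_pmf.prob (map_pmf (\<lambda>f. f e) M) {True}"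
    by (simp add: E_def vimage_def)
  \<comment> \<open>The probability is \<open>p\<close> if \<open>e\<close> lies in \<open>A\<close>
    and 0 otherwise, since the coordinate is then constantly \<open>False\<close>.\<close>
  also have "\<dots> \<le> p"
    using p fin unfolding M_def
    by (subst Pi_pmf_component) (auto simp: measure_pmf_single)
  finally have E: "measure_pmf.prob M E \<le> p" .
  have unset: "f(e := False) = f" if "f \<notin> E" for f
    using that by (intro fun_upd_idem) (auto simp: E_def)
  have le: "measure_pmf.prob M U \<le> measure_pmf.prob M V + p" if "U \<subseteq> V \<union> E" for U V
  proof -
    have "measure_pmf.prob M U \<le> measure_pmf.prob M (V \<union> E)"
      using that by (intro measure_pmf.finite_measure_mono) auto
    also have "\<dots> \<le> measure_pmf.prob M V + measure_pmf.prob M E"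
      by (intro measure_Un_le) auto
    finally show ?thesis using E by linarith
  qed
  have dis: "(S - {e}) \<inter> (T - {e}) = {}"
    using ST by auto
  have "measure_pmf.prob M (X \<inter> Y) \<le> measure_pmf.prob M (X' \<inter> Y') + p"
    by (rule le) (use unset in \<open>auto simp: X'_def Y'_def\<close>)
  also have "measure_pmf.prob M (X' \<inter> Y') = measure_pmf.prob M X' * measure_pmf.prob M Y'"
    unfolding M_def
  proof (rule prob_Pi_pmf_Int_disjoint[OF fin dis])
    fix f g :: "'a \<Rightarrow> bool"
    show "f \<in> X' \<longleftrightarrow> g \<in> X'" if "\<And>x. x \<in> S - {e} \<Longrightarrow> f x = g x"
      unfolding X'_def mem_Collect_eq using that by (intro X) auto
    show "f \<in> Y' \<longleftrightarrow> g \<in> Y'" if "\<And>x. x \<in> T - {e} \<Longrightarrow> f x = g x"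
      unfolding Y'_def mem_Collect_eq using that by (intro Y) auto
  qed
  also have "\<dots> \<le> (measure_pmf.prob M X + p) * (measure_pmf.prob M Y + p)"
    using p by (intro mult_mono le add_nonneg_nonneg) (use unset in \<open>auto simp: X'_def Y'_def\<close>)
  \<comment> \<open>Expanding the product leaves three error terms, each at most \<open>p\<close>;
    the fourth \<open>p\<close> comes from the intersection.\<close>
  also have "\<dots> + p \<le> measure_pmf.prob M X * measure_pmf.prob M Y + 4 * p"
  proof -
    have "measure_pmf.prob M X * p \<le> 1 * p" "p * measure_pmf.prob M Y \<le> p * 1" "p * p \<le> p * 1"
      using p by (intro mult_left_mono mult_right_mono; auto)+
    thus ?thesis by (simp add: algebra_simps)
  qed
  finally show ?thesis by simp
qed

text \<open>Chebyshev's inequality for the number of events that occur: in the double sum for the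
  variance each diagonal term is at most 1 and each off-diagonal covariance at most
  \<open>c\<close>.\<close>

lemma prob_card_events_ge:
  assumes fin: "finite V" and a: "a > 0" and c: "c \<ge> 0"
    and cov: "\<And>u v. u \<in> V \<Longrightarrow> v \<in> V \<Longrightarrow> u \<noteq> v \<Longrightarrow>
      measure_pmf.prob M (X u \<inter> X v) \<le> measure_pmf.prob M (X u) * measure_pmf.prob M (X v) + c"
  shows "measure_pmf.prob M {x. real (card {v \<in> V. x \<in> X v}) \<ge> (\<Sum>v\<in>V. measure_pmf.prob M (X v)) + a}
    \<le> (real (card V) + c * (real (card V))\<^sup>2) / a\<^sup>2"
proof -
  define F where "F x = (\<Sum>v\<in>V. indicator (X v) x :: real)" for x
  have F: "F x = real (card {v \<in> V. x \<in> X v})" for x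
    unfolding F_def using fin by (simp add: indicator_def sum.If_cases Int_def)
  have int_ind [simp]: "integrable (measure_pmf M) (\<lambda>x. indicator A x :: real)" for A
    by (intro measure_pmf.integrable_const_bound[where B = 1]) (auto simp: indicator_def)
  have F2: "(F x)\<^sup>2 = (\<Sum>u\<in>V. \<Sum>v\<in>V. indicator (X u \<inter> X v) x)" for x
    by (simp add: F_def power2_eq_square sum_product indicator_inter_arith)
  have int2: "integrable (measure_pmf M) (\<lambda>x. (F x)\<^sup>2)"
    unfolding F2 by (intro Bochner_Integration.integrable_sum) auto
  have int1: "integrable (measure_pmf M) F"
    unfolding F_def[abs_def] by (intro Bochner_Integration.integrable_sum) auto
  have EF: "measure_pmf.expectation M F = (\<Sum>v\<in>V. measure_pmf.prob M (X v))"
    unfolding F_def[abs_def] by (subst Bochner_Integration.integral_sum) auto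
  have EF2: "measure_pmf.expectation M (\<lambda>x. (F x)\<^sup>2) = (\<Sum>u\<in>V. \<Sum>v\<in>V. measure_pmf.prob M (X u \<inter> X v))"
    unfolding F2 by (subst Bochner_Integration.integral_sum;
      (subst Bochner_Integration.integral_sum)?; auto)
  have diag: "measure_pmf.prob M A - measure_pmf.prob M A * measure_pmf.prob M A \<le> 1" for A
    using measure_pmf.prob_le_1[of M A] zero_le_square[of "measure_pmf.prob M A"] by linarith
  have "measure_pmf.variance M F = measure_pmf.expectation M (\<lambda>x. (F x)\<^sup>2) - (measure_pmf.expectation M F)\<^sup>2"
    using int1 int2 by (rule measure_pmf.variance_eq)
  also have "\<dots> = (\<Sum>u\<in>V. \<Sum>v\<in>V. measure_pmf.prob M (X u \<inter> X v) - measure_pmf.prob M (X u) * measure_pmf.prob M (X v))"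
    unfolding EF EF2 by (simp add: power2_eq_square sum_product sum_subtractf)
  \<comment> \<open>Adding \<open>c\<close> on the diagonal too is harmless because c >= 0, and
    makes the sum evaluate cleanly.\<close>
  also have "\<dots> \<le> (\<Sum>u\<in>V. \<Sum>v\<in>V. (if u = v then 1 else 0) + c)"
  proof (intro sum_mono)
    fix u v assume "u \<in> V" "v \<in> V"
    thus "measure_pmf.prob M (X u \<inter> X v) - measure_pmf.prob M (X u) * measure_pmf.prob M (X v)
          \<le> (if u = v then 1 else 0) + c"
      using cov[of u v] c diag[of "X v"] by (cases "u = v") (auto intro: order_trans)
  qed
  also have "\<dots> = real (card V) + c * (real (card V))\<^sup>2"
    using fin by (simp add: sum.distrib power2_eq_square algebra_simps)
  finally have var: "measure_pmf.variance M F \<le> real (card V) + c * (real (card V))\<^sup>2" .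
  have "measure_pmf.prob M {x. real (card {v \<in> V. x \<in> X v}) \<ge> (\<Sum>v\<in>V. measure_pmf.prob M (X v)) + a}
      \<le> measure_pmf.prob M {x \<in> space M. \<bar>F x - measure_pmf.expectation M F\<bar> \<ge> a}"
    unfolding EF F by (intro measure_pmf.finite_measure_mono) auto
  also have "\<dots> \<le> measure_pmf.variance M F / a\<^sup>2"
    using a int2 by (intro measure_pmf.Chebyshev_inequality) auto
  also have "\<dots> \<le> (real (card V) + c * (real (card V))\<^sup>2) / a\<^sup>2"
    using var a by (intro divide_right_mono) auto
  finally show ?thesis .
qed

section \<open>One step of majority dynamics\<close>

abbreviation edge_pmf :: "nat \<Rightarrow> real \<Rightarrow> (nat set \<Rightarrow> bool) pmf" where
  "edge_pmf N p \<equiv> Pi_pmf (all_edges N) False (\<lambda>_. bernoulli_pmf p)"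

text \<open>The event lives on Boolean edge labels rather than graphs, so that the lemmas on
  \<open>Pi_pmf\<close> apply directly. Arbitrary sets \<open>B\<close> and \<open>R\<close> allow
  the colour classes to be replaced by extremal ones.\<close>

definition minority_event :: "nat set \<Rightarrow> nat set \<Rightarrow> nat \<Rightarrow> (nat set \<Rightarrow> bool) set" where
  "minority_event B R v = {f. card {w \<in> B - {v}. f {v, w}} \<le> card {w \<in> R - {v}. f {v, w}}}"

lemma finite_all_edges [simp]: "finite (all_edges N)"
  unfolding all_edges_def by (rule finite_subset[of _ "Pow {1..N}"]) auto

lemma doubleton_in_all_edges: "v \<in> {1..N} \<Longrightarrow> w \<in> {1..N} - {v} \<Longrightarrow> {v, w} \<in> all_edges N"
  by (auto simp: all_edges_def card_insert_if)

text \<open>Away from \<open>v\<close> the map from w to {v, w} is injective, so the labels of the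
  edges at \<open>v\<close> are independent Bernoulli variables indexed by the other endpoint.
  Disjoint \<open>B\<close> and \<open>R\<close> use disjoint families of them, which gives two
  independent binomial counts.\<close>

lemma map_star_edge_pmf:
  assumes p: "p \<in> {0..1}" and v: "v \<in> {1..N}"
    and BR: "B \<subseteq> {1..N} - {v}" "R \<subseteq> {1..N} - {v}" "B \<inter> R = {}"
  shows "map_pmf (\<lambda>f. (card {w \<in> B. f {v, w}}, card {w \<in> R. f {v, w}})) (edge_pmf N p) =
         pair_pmf (binomial_pmf (card B) p) (binomial_pmf (card R) p)"
proof -
  let ?q = "\<lambda>_. bernoulli_pmf p"
  define h where "h w = {v, w}" for w
  define W where "W = B \<union> R"
  have fin: "finite B" "finite R" "finite W"
    using BR by (auto simp: W_def intro: finite_subset)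
  have inj: "h x = h w \<longleftrightarrow> x = w" if "w \<in> W" for x w
    using that BR by (auto simp: h_def W_def doubleton_eq_iff)
  have hW: "h ` W \<subseteq> all_edges N"
    using BR v by (auto simp: W_def h_def simp del: Diff_iff intro!: doubleton_in_all_edges)
  have "Pi_pmf W False ?q = map_pmf (\<lambda>g. g \<circ> h) (Pi_pmf (h ` W) False ?q)"
    using fin inj by (intro Pi_pmf_bij_betw) (auto simp: bij_betw_def inj_on_def)
  also have "Pi_pmf (h ` W) False ?q = map_pmf (\<lambda>f x. if x \<in> h ` W then f x else False) (edge_pmf N p)"
    by (intro Pi_pmf_subset hW) auto
  finally have W: "Pi_pmf W False ?q = map_pmf (\<lambda>f w. w \<in> W \<and> f (h w)) (edge_pmf N p)"
    using inj by (auto simp: pmf.map_comp o_def image_iff intro!: pmf.map_cong ext)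
  have "map_pmf (\<lambda>f. (card {w \<in> B. f {v, w}}, card {w \<in> R. f {v, w}})) (edge_pmf N p) =
        map_pmf (\<lambda>g. (card {w \<in> B. g w}, card {w \<in> R. g w})) (Pi_pmf W False ?q)"
    unfolding W pmf.map_comp
    by (intro pmf.map_cong refl) (auto simp: h_def W_def intro!: arg_cong[where f = card])
  also have "Pi_pmf W False ?q = map_pmf (\<lambda>(f, g) x. if x \<in> B then f x else g x)
        (pair_pmf (Pi_pmf B False ?q) (Pi_pmf R False ?q))"
    unfolding W_def using fin BR by (intro Pi_pmf_union) auto
  also have "map_pmf (\<lambda>g. (card {w \<in> B. g w}, card {w \<in> R. g w})) \<dots> =
        map_pmf (\<lambda>(f, g). (card {w \<in> B. f w}, card {w \<in> R. g w}))
          (pair_pmf (Pi_pmf B False ?q) (Pi_pmf R False ?q))"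
    unfolding pmf.map_comp using BR
    by (intro pmf.map_cong refl) (auto intro!: arg_cong[where f = card])
  also have "\<dots> = pair_pmf (binomial_pmf (card B) p) (binomial_pmf (card R) p)"
    using fin p by (subst map_pair) (simp add: binomial_pmf_altdef'[symmetric])
  finally show ?thesis .
qed

lemma prob_minority_event:
  assumes "p \<in> {0..1}" "v \<in> {1..N}" "B \<subseteq> {1..N}" "R \<subseteq> {1..N}" "B \<inter> R = {}"
  shows "measure_pmf.prob (edge_pmf N p) (minority_event B R v) =
         minority_prob (card (B - {v})) (card (R - {v})) p"
proof -
  have "minority_prob (card (B - {v})) (card (R - {v})) p =
        measure_pmf.prob (map_pmf (\<lambda>f. (card {w \<in> B - {v}. f {v, w}}, card {w \<in> R - {v}. f {v, w}}))
          (edge_pmf N p)) {(i, j). i \<le> j}"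
    unfolding minority_prob_def using assms by (subst map_star_edge_pmf) auto
  thus ?thesis
    by (simp add: minority_event_def vimage_def)
qed

lemma minority_event_mono:
  assumes "finite B" "finite R'" "B' \<subseteq> B" "R \<subseteq> R'"
  shows "minority_event B R v \<subseteq> minority_event B' R' v"
proof
  fix f assume "f \<in> minority_event B R v"
  moreover have "card {w \<in> B' - {v}. f {v, w}} \<le> card {w \<in> B - {v}. f {v, w}}"
    "card {w \<in> R - {v}. f {v, w}} \<le> card {w \<in> R' - {v}. f {v, w}}"
    using assms by (auto intro!: card_mono)
  ultimately show "f \<in> minority_event B' R' v"
    by (auto simp: minority_event_def)
qed

section \<open>Comparison with an extremal configuration\<close>

lemma blue_conv_red:
  assumes "y \<in> {1..N} \<rightarrow> {-1, 1}"
  shows "blue N y = {1..N} - red N y"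
  using assms by (auto simp: blue_def red_def Pi_def)

lemma red_subset: "red N y \<subseteq> {1..N}"
  by (auto simp: red_def)

lemma finite_red [simp]: "finite (red N y)"
  using red_subset by (rule finite_subset) auto

lemma card_red_le: "card (red N y) \<le> N"
  using card_mono[OF _ red_subset, of N y] by simp

lemma advantage_conv_red:
  assumes "y \<in> {1..N} \<rightarrow> {-1, 1}"
  shows "advantage N y = int N - 2 * int (card (red N y))"
  using card_red_le[of N y] red_subset[of N y] unfolding advantage_def blue_conv_red[OF assms]
  by (subst card_Diff_subset) auto

text \<open>By monotonicity it suffices to recolour vertices other than \<open>v\<close> until
  exactly \<open>m\<close> of them are red. The bound then depends neither on \<open>v\<close>, nor
  on its colour, nor on the configuration.\<close>

lemma prob_minority_event_le:
  assumes p: "p \<in> {0..1}" and y: "y \<in> {1..N} \<rightarrow> {-1, 1}" and v: "v \<in> {1..N}"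
    and m: "card (red N y) \<le> m" "m \<le> N - 1"
  shows "measure_pmf.prob (edge_pmf N p) (minority_event (blue N y) (red N y) v)
         \<le> minority_prob (N - 1 - m) m p"
proof -
  have "card (red N y - {v}) \<le> m"
    using m card_mono[OF finite_red, of "red N y - {v}" N y] by auto
  moreover have "m \<le> card ({1..N} - {v})"
    using m v by simp
  moreover have "red N y - {v} \<subseteq> {1..N} - {v}"
    using red_subset by auto
  \<comment> \<open>The condition m <= N - 1 leaves room for \<open>m\<close> red vertices besides
    \<open>v\<close>.\<close>
  ultimately obtain R where R: "red N y - {v} \<subseteq> R" "R \<subseteq> {1..N} - {v}" "card R = m"
    using exists_subset_between[of "red N y - {v}" m "{1..N} - {v}"] by auto
  define B where "B = {1..N} - {v} - R"
  have finR: "finite R"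
    using R(2) by (rule finite_subset) auto
  have cardB: "card B = N - 1 - m"
    unfolding B_def using R finR v by (subst card_Diff_subset) auto
  have eq: "minority_event C D v = minority_event (C - {v}) (D - {v}) v" for C D
    by (simp add: minority_event_def)
  have "minority_event (blue N y) (red N y) v \<subseteq> minority_event B R v"
    unfolding blue_conv_red[OF y] eq[of "{1..N} - red N y" "red N y"]
    using R finR by (intro minority_event_mono) (auto simp: B_def)
  hence "measure_pmf.prob (edge_pmf N p) (minority_event (blue N y) (red N y) v)
         \<le> measure_pmf.prob (edge_pmf N p) (minority_event B R v)"
    by (intro measure_pmf.finite_measure_mono) auto
  also have "\<dots> = minority_prob (card (B - {v})) (card (R - {v})) p"
    using R p v by (intro prob_minority_event) (auto simp: B_def)
  also have "\<dots> = minority_prob (N - 1 - m) m p"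
  proof -
    have "B - {v} = B" "R - {v} = R"
      using R by (auto simp: B_def)
    thus ?thesis
      by (simp add: cardB R)
  qed
  finally show ?thesis .
qed

section \<open>Red vertices after one update\<close>

lemma neighbors_Int:
  assumes "v \<in> {1..N}" "S \<subseteq> {1..N}"
  shows "neighbors {e \<in> all_edges N. f e} v \<inter> S = {w \<in> S - {v}. f {v, w}}"
proof -
  have "{v} \<notin> all_edges N"
    by (simp add: all_edges_def)
  thus ?thesis
    using assms doubleton_in_all_edges[OF assms(1)] by (auto simp: neighbors_def)
qed

lemma red_majority_step_imp_minority_event:
  assumes "v \<in> red N (majority_step N {e \<in> all_edges N. f e} y)"
  shows "f \<in> minority_event (blue N y) (red N y) v"
proof -
  have v: "v \<in> {1..N}"
    using assms red_subset by blast
  have sub: "blue N y \<subseteq> {1..N}" "red N y \<subseteq> {1..N}"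
    by (auto simp: blue_def red_def)
  show ?thesis
    using assms unfolding red_def[of N "majority_step N {e \<in> all_edges N. f e} y"] majority_step_def
      neighbors_Int[OF v sub(1)] neighbors_Int[OF v sub(2)] minority_event_def
    by (auto simp: neighbors_Int[OF v sub(1)] neighbors_Int[OF v sub(2)] split: if_splits)
qed

lemma prob_no_red_majority_step_ge:
  assumes p: "p \<in> {0..1}" and y: "y \<in> {1..N} \<rightarrow> {-1, 1}" 
    and m: "card (red N y) \<le> m" "m \<le> N - 1"
  shows "measure_pmf.prob (erdos_renyi N p) {g. red N (majority_step N g y) = {}}
         \<ge> 1 - real N * minority_prob (N - 1 - m) m p"
proof -
  let ?E = "\<lambda>v. minority_event (blue N y) (red N y) v"
  have "measure_pmf.prob (edge_pmf N p) (\<Union>v\<in>{1..N}. ?E v)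
        \<le> (\<Sum>v\<in>{1..N}. measure_pmf.prob (edge_pmf N p) (?E v))"
    by (intro measure_pmf.finite_measure_subadditive_finite) auto
  also have "\<dots> \<le> (\<Sum>v\<in>{1..N}. minority_prob (N - 1 - m) m p)"
    by (intro sum_mono prob_minority_event_le assms)
  finally have le: "measure_pmf.prob (edge_pmf N p) (\<Union>v\<in>{1..N}. ?E v)
        \<le> real N * minority_prob (N - 1 - m) m p" by simp
  have "1 - measure_pmf.prob (edge_pmf N p) (\<Union>v\<in>{1..N}. ?E v) =
        measure_pmf.prob (edge_pmf N p) (- (\<Union>v\<in>{1..N}. ?E v))"
    using measure_pmf.prob_compl[of "\<Union>v\<in>{1..N}. ?E v" "edge_pmf N p"] by (simp add: Compl_eq_Diff_UNIV)
  also have "\<dots> \<le> measure_pmf.prob (edge_pmf N p)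
      {f. red N (majority_step N {e \<in> all_edges N. f e} y) = {}}"
  proof (rule measure_pmf.finite_measure_mono)
    show "- (\<Union>v\<in>{1..N}. ?E v) \<subseteq> {f. red N (majority_step N {e \<in> all_edges N. f e} y) = {}}"
    proof (intro subsetI CollectI equals0I)
      fix f v
      assume f: "f \<in> - (\<Union>v\<in>{1..N}. ?E v)"
        and v: "v \<in> red N (majority_step N {e \<in> all_edges N. f e} y)"
      thus False
        using red_majority_step_imp_minority_event[OF v] red_subset[of N] by blast
    qed
  qed simp
  finally show ?thesis
    using le by (simp add: erdos_renyi_def vimage_def)
qed

text \<open>The red vertices after the step are among those whose minority event occurs. The
  expected number of such events is at most N q, and the second-moment bound applies with covariance
  bound 4p.\<close>

lemma prob_card_red_majority_step_ge:
  assumes p: "p \<in> {0..1}" and y: "y \<in> {1..N} \<rightarrow> {-1, 1}"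
    and m: "card (red N y) \<le> m" "m \<le> N - 1" and a: "a > 0"
    and q: "minority_prob (N - 1 - m) m p \<le> q"
  shows "measure_pmf.prob (erdos_renyi N p)
      {g. real (card (red N (majority_step N g y))) \<ge> real N * q + a}
    \<le> (real N + 4 * p * (real N)\<^sup>2) / a\<^sup>2"
proof -
  let ?E = "\<lambda>v. minority_event (blue N y) (red N y) v"
  let ?P = "measure_pmf.prob (edge_pmf N p)"
  have "(\<Sum>v\<in>{1..N}. ?P (?E v)) \<le> (\<Sum>v\<in>{1..N}. q)"
    by (intro sum_mono order_trans[OF prob_minority_event_le q] assms)
  hence sum: "(\<Sum>v\<in>{1..N}. ?P (?E v)) \<le> real N * q" by simp
  have le: "card (red N (majority_step N {e \<in> all_edges N. f e} y)) \<le> card {v \<in> {1..N}. f \<in> ?E v}" for f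
  proof (rule card_mono)
    show "red N (majority_step N {e \<in> all_edges N. f e} y) \<subseteq> {v \<in> {1..N}. f \<in> ?E v}"
      using red_majority_step_imp_minority_event red_subset by blast
  qed simp
  have "{f. real (card (red N (majority_step N {e \<in> all_edges N. f e} y))) \<ge> real N * q + a}
      \<subseteq> {f. real (card {v \<in> {1..N}. f \<in> ?E v}) \<ge> (\<Sum>v\<in>{1..N}. ?P (?E v)) + a}"
  proof (intro subsetI CollectI)
    fix f assume "f \<in> {f. real (card (red N (majority_step N {e \<in> all_edges N. f e} y))) \<ge> real N * q + a}"
    thus "real (card {v \<in> {1..N}. f \<in> ?E v}) \<ge> (\<Sum>v\<in>{1..N}. ?P (?E v)) + a"
      using sum le[of f] by simp
  qed
  hence "?P {f. real (card (red N (majority_step N {e \<in> all_edges N. f e} y))) \<ge> real N * q + a}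
      \<le> ?P {f. real (card {v \<in> {1..N}. f \<in> ?E v}) \<ge> (\<Sum>v\<in>{1..N}. ?P (?E v)) + a}"
    by (intro measure_pmf.finite_measure_mono) auto
  also have "\<dots> \<le> (real (card {1..N}) + (4 * p) * (real (card {1..N}))\<^sup>2) / a\<^sup>2"
  proof (rule prob_card_events_ge)
    fix u v :: nat assume "u \<noteq> v"
    show "?P (?E u \<inter> ?E v) \<le> ?P (?E u) * ?P (?E v) + 4 * p"
    \<comment> \<open>The event at a vertex reads only labels of pairs containing it, and two
      distinct vertices share just one such pair.\<close>
    proof (rule prob_Pi_pmf_Int_common_coordinate[where S = "range (\<lambda>w. {u, w})"
          and T = "range (\<lambda>w. {v, w})" and e = "{u, v}"])
      show "range (\<lambda>w. {u, w}) \<inter> range (\<lambda>w. {v, w}) \<subseteq> {{u, v}}"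
        using \<open>u \<noteq> v\<close> by (auto simp: doubleton_eq_iff)
    qed (use p in \<open>auto simp: minority_event_def\<close>)
  qed (use a p in auto)
  finally show ?thesis
    by (simp add: erdos_renyi_def vimage_def)
qed

lemma majority_step_range: "y \<in> {1..N} \<rightarrow> {-1, 1} \<Longrightarrow> majority_step N g y \<in> {1..N} \<rightarrow> {-1, 1}"
  by (auto simp: majority_step_def Pi_def)

section \<open>The first two components of the graph sequence\<close>

text \<open>A graph in the sample space may be any set of sets of naturals. Only its part inside the
  vertex set influences the dynamics, and this is what makes the two-day event measurable.\<close>

lemma majority_step_cong:
  assumes "g \<inter> Pow {1..N} = g' \<inter> Pow {1..N}" "\<And>v. v \<in> {1..N} \<Longrightarrow> y v = y' v" "v \<in> {1..N}"
  shows "majority_step N g y v = majority_step N g' y' v"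
proof -
  have eq: "blue N y = blue N y'" "red N y = red N y'"
    using assms(2) by (auto simp: blue_def red_def)
  have "{v, w} \<in> g \<longleftrightarrow> {v, w} \<in> g'" if "w \<in> {1..N}" for w
  proof -
    have "{v, w} \<in> g \<inter> Pow {1..N} \<longleftrightarrow> {v, w} \<in> g' \<inter> Pow {1..N}"
      by (simp only: assms(1))
    thus ?thesis
      using that assms(3) by simp
  qed
  hence "neighbors g v \<inter> blue N y = neighbors g' v \<inter> blue N y"
    "neighbors g v \<inter> red N y = neighbors g' v \<inter> red N y"
    by (auto simp: blue_def red_def neighbors_def)
  thus ?thesis
    using assms(2,3) by (simp add: majority_step_def eq)
qed

lemma PiM_measure_pmf_Collect:
  assumes "J \<subseteq> I" "finite J"
  shows "{G \<in> space (\<Pi>\<^sub>M t\<in>I. measure_pmf M). \<forall>t\<in>J. G t \<in> X t} \<in> sets (\<Pi>\<^sub>M t\<in>I. measure_pmf M)"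
    and "measure (\<Pi>\<^sub>M t\<in>I. measure_pmf M) {G \<in> space (\<Pi>\<^sub>M t\<in>I. measure_pmf M). \<forall>t\<in>J. G t \<in> X t} =
      (\<Prod>t\<in>J. measure_pmf.prob M (X t))"
proof -
  interpret product_prob_space "\<lambda>_. measure_pmf M" I
    by unfold_locales
  show "{G \<in> space (\<Pi>\<^sub>M t\<in>I. measure_pmf M). \<forall>t\<in>J. G t \<in> X t} \<in> sets (\<Pi>\<^sub>M t\<in>I. measure_pmf M)"
    using assms by (intro sets.sets_Collect_finite_All) (auto intro!: sets_Collect_single')
  have "emeasure (\<Pi>\<^sub>M t\<in>I. measure_pmf M) {G \<in> space (\<Pi>\<^sub>M t\<in>I. measure_pmf M). \<forall>t\<in>J. G t \<in> X t} =
      (\<Prod>t\<in>J. emeasure (measure_pmf M) (X t))"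
    using assms by (intro emeasure_PiM_Collect) auto
  thus "measure (\<Pi>\<^sub>M t\<in>I. measure_pmf M) {G \<in> space (\<Pi>\<^sub>M t\<in>I. measure_pmf M). \<forall>t\<in>J. G t \<in> X t} =
      (\<Prod>t\<in>J. measure_pmf.prob M (X t))"
    by (intro measure_eq_emeasure_eq_ennreal)
       (simp_all add: measure_pmf.emeasure_eq_measure prod_ennreal prod_nonneg)
qed

text \<open>Measurability is a genuine issue here: the components carry the discrete
  \<open>\<sigma>\<close>-algebra on an uncountable type, so an event about two components is only measurable because
  it depends on one of them through the finitely many values of \<open>h\<close>.\<close>

lemma measure_PiM_two_components_ge:
  fixes M :: "'a pmf" and i j :: 'i
  assumes ij: "i \<in> I" "j \<in> I" "i \<noteq> j"
    and fin: "finite (range h)" and Q: "\<And>g g'. Q g g' \<longleftrightarrow> Q (h g) g'"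
    and c: "0 \<le> c" "\<And>g. g \<in> A \<Longrightarrow> c \<le> measure_pmf.prob M {g'. Q g g'}"
  shows "c * measure_pmf.prob M A \<le>
    measure (\<Pi>\<^sub>M t\<in>I. measure_pmf M) {G \<in> space (\<Pi>\<^sub>M t\<in>I. measure_pmf M). Q (G i) (G j)}"
proof -
  let ?P = "\<Pi>\<^sub>M t\<in>I. measure_pmf M"
  \<comment> \<open>Fixing the value of \<open>h\<close> at component \<open>i\<close> turns the
    joint event into a cylinder event, which is measurable and has product measure.\<close>
  define S where "S k = {G \<in> space ?P. h (G i) = k \<and> Q k (G j)}" for k
  define H where "H = (\<lambda>k. {g. h g = k})"
  have c': "c \<le> measure_pmf.prob M {g'. Q (h g) g'}" if "g \<in> A" for g
    using c(2)[OF that] by (simp only: Q[of g])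
  interpret P: prob_space ?P
    by (intro prob_space_PiM measure_pmf.prob_space_axioms)
  have S_eq: "S k = {G \<in> space ?P. \<forall>t\<in>{i, j}. G t \<in> (if t = i then H k else {g'. Q k g'})}" for k
    using ij by (auto simp: S_def H_def)
  have S_sets: "S k \<in> sets ?P" for k
    unfolding S_eq using ij by (intro PiM_measure_pmf_Collect) auto
  have S_meas: "measure ?P (S k) = measure_pmf.prob M (H k) * measure_pmf.prob M {g'. Q k g'}" for k
    unfolding S_eq using ij by (subst PiM_measure_pmf_Collect(2)) auto
  \<comment> \<open>\<open>A\<close> need not be a union of fibres of \<open>h\<close>, but the
    fibres that meet it cover it, and the lower bound \<open>c\<close> holds on each of
    these.\<close>
  have "c * measure_pmf.prob M A \<le> c * measure_pmf.prob M (\<Union>k\<in>h ` A. H k)"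
    using c by (intro mult_left_mono measure_pmf.finite_measure_mono) (auto simp: H_def)
  also have "measure_pmf.prob M (\<Union>k\<in>h ` A. H k) = (\<Sum>k\<in>h ` A. measure_pmf.prob M (H k))"
    using fin by (intro measure_pmf.finite_measure_finite_Union)
                 (auto simp: H_def disjoint_family_on_def finite_subset[OF image_mono[OF subset_UNIV]])
  also have "c * \<dots> = (\<Sum>k\<in>h ` A. measure_pmf.prob M (H k) * c)"
    by (simp add: sum_distrib_left mult.commute)
  also have "\<dots> \<le> (\<Sum>k\<in>h ` A. measure ?P (S k))"
    unfolding S_meas using c' by (intro sum_mono mult_left_mono) auto
  also have "\<dots> \<le> (\<Sum>k\<in>range h. measure ?P (S k))"
    using fin by (intro sum_mono2) auto
  also have "\<dots> = measure ?P (\<Union>k\<in>range h. S k)"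
    using fin S_sets by (intro P.finite_measure_finite_Union[symmetric])
                        (auto simp: S_def disjoint_family_on_def)
  also have "(\<Union>k\<in>range h. S k) = {G \<in> space ?P. Q (G i) (G j)}"
    by (auto simp: S_def Q[symmetric]) (metis Q)
  finally show ?thesis .
qed

lemma prob_no_red_1:
  "prob_no_red N p y 1 = measure_pmf.prob (erdos_renyi N p) {g. red N (majority_step N g y) = {}}"
  using PiM_measure_pmf_Collect(2)[of "{Suc 0}" "{1..}" "erdos_renyi N p"
      "\<lambda>_. {g. red N (majority_step N g y) = {}}"]
  unfolding prob_no_red_def graph_sequence_def One_nat_def configuration.simps by simp

text \<open>The second graph is independent of the first, so a success probability of at least
  \<open>c\<close> for every first graph in \<open>A\<close> multiplies with the probability of
  \<open>A\<close>.\<close>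

lemma prob_no_red_2_ge:
  assumes "0 \<le> c"
    and "\<And>g. g \<in> A \<Longrightarrow>
      c \<le> measure_pmf.prob (erdos_renyi N p) {g'. red N (majority_step N g' (majority_step N g y)) = {}}"
  shows "c * measure_pmf.prob (erdos_renyi N p) A \<le> prob_no_red N p y 2"
proof -
  define h where "h = (\<lambda>g. g \<inter> Pow {1..N})"
  have "red N (majority_step N g' (majority_step N g y)) = red N (majority_step N g' (majority_step N (h g) y))" for g g'
  proof -
    have "majority_step N g y v = majority_step N (h g) y v" if "v \<in> {1..N}" for v
      using that by (intro majority_step_cong) (auto simp: h_def)
    hence "majority_step N g' (majority_step N g y) v = majority_step N g' (majority_step N (h g) y) v"
      if "v \<in> {1..N}" for v
      using that by (intro majority_step_cong[OF refl])
    thus ?thesis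
      by (auto simp: red_def)
  qed
  moreover have "finite (range h)"
    by (rule finite_subset[of _ "Pow (Pow {1..N})"]) (auto simp: h_def)
  ultimately show ?thesis
    unfolding prob_no_red_def graph_sequence_def numeral_2_eq_2 configuration.simps
    using assms by (intro measure_PiM_two_components_ge[where h = h]) auto
qed

section \<open>Normal approximation\<close>

text \<open>With x = p (z - 1), the base is 1 + x and differs from exp x by a second-order Taylor
  remainder. Both lie in the closed unit disc, so their \<open>n\<close>-th powers differ by at most
  n times as much. The last two claims allow products of such powers to be compared as well.\<close>

lemma norm_exp_power_diff:
  fixes z :: complex
  assumes p: "p \<in> {0..1}" and z: "norm z = 1"
  shows "norm ((of_real (1 - p) + of_real p * z) ^ n - exp (of_nat n * (of_real p * (z - 1))))
         \<le> real n * (4 * exp 2 * p\<^sup>2)"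
    and "norm (of_real (1 - p) + of_real p * z) \<le> 1"
    and "norm (exp (of_real p * (z - 1))) \<le> 1"
proof -
  let ?x = "of_real p * (z - 1)"
  have "norm (of_real (1 - p) + of_real p * z) \<le> norm (of_real (1 - p) :: complex) + norm (of_real p * z)"
    by (rule norm_triangle_ineq)
  also have "\<dots> = 1"
    using p z by (simp add: norm_mult del: of_real_diff)
  finally show 1: "norm (of_real (1 - p) + of_real p * z) \<le> 1" .
  have "Re z \<le> 1"
    using complex_Re_le_cmod[of z] z by simp
  thus 2: "norm (exp ?x) \<le> 1"
    using p by (auto intro!: mult_nonneg_nonpos)
  have "norm (z - 1) \<le> 2"
    using norm_triangle_ineq4[of z 1] z by simp
  hence x: "norm ?x \<le> 2 * p"
    using p mult_left_mono[of "norm (z - 1)" 2 p] by (simp add: norm_mult mult.commute)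
  have "norm (exp ?x - (\<Sum>i\<le>1. ?x ^ i / fact i)) \<le> exp (norm ?x) * (norm ?x ^ Suc 1) / fact 1"
    by (rule Taylor_exp_field)
  \<comment> \<open>Here |x| <= 2p, and p <= 1 bounds the exponential factor by exp 2.\<close>
  also have "\<dots> \<le> exp 2 * (2 * p) ^ 2"
  proof -
    have "exp (norm ?x) \<le> exp 2"
      using x p by simp
    moreover have "norm ?x * norm ?x \<le> (2 * p) * (2 * p)"
      using x p by (intro mult_mono) auto
    ultimately have "exp (norm ?x) * (norm ?x * norm ?x) \<le> exp 2 * ((2 * p) * (2 * p))"
      by (rule mult_mono) auto
    thus ?thesis
      by (simp add: power2_eq_square)
  qed
  finally have 3: "norm (exp ?x - (1 + ?x)) \<le> 4 * exp 2 * p\<^sup>2"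
    by (simp add: power_mult_distrib)
  have "norm ((of_real (1 - p) + of_real p * z) ^ n - exp ?x ^ n) \<le>
        real n * norm ((of_real (1 - p) + of_real p * z) - exp ?x)"
    using 1 2 by (rule norm_power_diff)
  also have "norm ((of_real (1 - p) + of_real p * z) - exp ?x) = norm (exp ?x - (1 + ?x))"
    by (subst norm_minus_commute) (simp add: algebra_simps)
  also have "real n * norm (exp ?x - (1 + ?x)) \<le> real n * (4 * exp 2 * p\<^sup>2)"
    using 3 by (intro mult_left_mono) auto
  finally show "norm ((of_real (1 - p) + of_real p * z) ^ n - exp (of_nat n * ?x))
      \<le> real n * (4 * exp 2 * p\<^sup>2)"
    by (simp only: exp_of_nat_mult)
qed

lemma norm_mult_diff_le:
  fixes a b c d :: "'a::real_normed_algebra_1"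
  assumes "norm a \<le> 1" "norm d \<le> 1"
  shows "norm (a * b - c * d) \<le> norm (a - c) + norm (b - d)"
proof -
  have "a * b - c * d = a * (b - d) + (a - c) * d"
    by (simp add: algebra_simps)
  also have "norm \<dots> \<le> norm a * norm (b - d) + norm (a - c) * norm d"
    by (intro norm_triangle_le add_mono norm_mult_ineq)
  also have "\<dots> \<le> 1 * norm (b - d) + norm (a - c) * 1"
    using assms by (intro add_mono mult_mono) auto
  finally show ?thesis by simp
qed

section \<open>The standard normal distribution function\<close>

text \<open>The density is positive everywhere, so every nonempty interval has positive mass.
  Strictness later converts K > \<open>K2_ER b\<close> into a gap between probabilities.\<close>

lemma std_normal_cdf_strict_mono:
  assumes "x < y"
  shows "std_normal_cdf x < std_normal_cdf y"
proof -
  interpret real_distribution std_normal_distribution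
    by (rule real_dist_normal_dist)
  have "{x<..y} \<notin> null_sets std_normal_distribution"
  proof
    assume "{x<..y} \<in> null_sets std_normal_distribution"
    hence "AE t in lborel. t \<in> {x<..y} \<longrightarrow> ennreal (std_normal_density t) = 0"
      by (subst (asm) null_sets_density_iff) auto
    moreover have "std_normal_density t > 0" for t
      by (rule normal_density_pos) simp
    ultimately have "AE t in lborel. t \<notin> {x<..y}"
      by (auto simp: ennreal_eq_0_iff not_le simp flip: not_less)
    hence "emeasure lborel {x<..y} = 0"
      by (subst (asm) AE_iff_measurable[of "{x<..y}"]) auto
    thus False
      using assms by simp
  qed
  hence "measure std_normal_distribution {x<..y} > 0"
    by (auto simp: null_sets_def emeasure_eq_measure zero_less_measure_iff)
  thus ?thesis
    using cdf_diff_eq[OF assms] by (simp add: std_normal_cdf_def)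
qed

lemma isCont_std_normal_cdf: "isCont std_normal_cdf x"
proof -
  interpret real_distribution std_normal_distribution
    by (rule real_dist_normal_dist)
  have "{x} \<in> null_sets std_normal_distribution"
  proof (subst null_sets_density_iff)
    have "AE t in lborel. t \<in> {x} \<longrightarrow> ennreal (std_normal_density t) = 0"
      using AE_lborel_singleton[of x] by eventually_elim auto
    thus "{x} \<in> sets lborel \<and> (AE t in lborel. t \<in> {x} \<longrightarrow> ennreal (std_normal_density t) = 0)"
      by simp
  qed simp
  thus ?thesis
    unfolding std_normal_cdf_def isCont_cdf by (auto simp: measure_def)
qed

text \<open>\<open>inv\<close> is meaningful only at values that are attained; the limits at both
  infinities and the intermediate value theorem show that \<open>q\<close> is one.\<close>

lemma std_normal_cdf_inv:
  assumes "0 < q" "q < 1"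
  shows "std_normal_cdf (inv std_normal_cdf q) = q"
proof -
  interpret real_distribution std_normal_distribution
    by (rule real_dist_normal_dist)
  obtain x where x: "std_normal_cdf x < q"
    using order_tendstoD(2)[OF cdf_lim_at_bot assms(1)]
    by (auto simp: std_normal_cdf_def eventually_at_bot_linorder)
  obtain y where y: "std_normal_cdf y > q"
    using order_tendstoD(1)[OF cdf_lim_at_top_prob assms(2)]
    by (auto simp: std_normal_cdf_def eventually_at_top_linorder)
  have "x \<le> y"
    using x y std_normal_cdf_strict_mono[of y x] by linarith
  hence "\<exists>z. x \<le> z \<and> z \<le> y \<and> std_normal_cdf z = q"
    using x y isCont_std_normal_cdf by (intro IVT) auto
  hence "q \<in> range std_normal_cdf"
    by auto
  thus ?thesis
    by (rule f_inv_into_f)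
qed

section \<open>Central limit theorem for the advantage among neighbours\<close>

lemma tendsto_one_minus_cos: "((\<lambda>x::real. x\<^sup>2 * (cos (t / x) - 1)) \<longlongrightarrow> - (t * t / 2)) at_top"
  by real_asymp

lemma tendsto_mult_sin: "((\<lambda>x::real. x * sin (t / x)) \<longlongrightarrow> t) at_top"
  by real_asymp

text \<open>The advantage enters with a negative sign, so that \<open>X \<le> Y\<close> is an upper tail event and the
  symmetry of the normal distribution is not needed.\<close>

definition advantage_distr :: "nat \<Rightarrow> nat \<Rightarrow> real \<Rightarrow> real \<Rightarrow> real \<Rightarrow> real measure" where
  "advantage_distr n m p c s = distr (measure_pmf (pair_pmf (binomial_pmf n p) (binomial_pmf m p))) borel
     (\<lambda>z. c - (real (fst z) - real (snd z)) / s)"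

lemma real_distribution_advantage_distr: "real_distribution (advantage_distr n m p c s)"
  unfolding advantage_distr_def by (rule prob_space.real_distribution_distr[OF measure_pmf.prob_space_axioms]) simp

lemma char_advantage_distr:
  assumes p: "p \<in> {0..1}"
  shows "char (advantage_distr n m p c s) t =
    iexp (t * c) * ((of_real (1 - p) + of_real p * iexp (- (t / s))) ^ n * (of_real (1 - p) + of_real p * iexp (t / s)) ^ m)"
proof -
  let ?M = "pair_pmf (binomial_pmf n p) (binomial_pmf m p)"
  have fin: "finite (set_pmf (binomial_pmf k p))" for k
    using p by auto
  have "char (advantage_distr n m p c s) t =
        measure_pmf.expectation ?M (\<lambda>z. iexp (t * (c - (real (fst z) - real (snd z)) / s)))"
    unfolding char_def advantage_distr_def by (subst integral_distr) auto
  also have "(\<lambda>z. iexp (t * (c - (real (fst z) - real (snd z)) / s))) =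
      (\<lambda>z. iexp (t * c) * (iexp (- (t / s)) ^ fst z * iexp (t / s) ^ snd z))"
    by (simp add: exp_of_nat_mult[symmetric] exp_add[symmetric] algebra_simps diff_divide_distrib)
  also have "measure_pmf.expectation ?M \<dots> =
      iexp (t * c) * measure_pmf.expectation ?M (\<lambda>z. iexp (- (t / s)) ^ fst z * iexp (t / s) ^ snd z)"
    by (rule integral_mult_right_zero)
  also have "measure_pmf.expectation ?M (\<lambda>z. iexp (- (t / s)) ^ fst z * iexp (t / s) ^ snd z) =
      (of_real (1 - p) + of_real p * iexp (- (t / s))) ^ n * (of_real (1 - p) + of_real p * iexp (t / s)) ^ m"
    by (subst expectation_pair_pmf_mult[OF fin fin]) (simp only: expectation_binomial_pmf_power[OF p])
  finally show ?thesis .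
qed

text \<open>Replacing each factor \<open>1 + p (\<omega> - 1)\<close> of the characteristic function by
  \<open>exp (p (\<omega> - 1))\<close> turns the two binomial variables into Poisson ones, at a total cost of
  order \<open>(n + m) p\<^sup>2\<close>.\<close>

lemma advantage_distr_clt:
  fixes n m :: "nat \<Rightarrow> nat" and p s :: "nat \<Rightarrow> real"
  assumes p: "\<forall>\<^sub>F k in sequentially. p k \<in> {0..1}"
    and s: "filterlim s at_top sequentially"
    and small: "(\<lambda>k. real (n k + m k) * (p k)\<^sup>2) \<longlonglongrightarrow> 0"
    and var: "(\<lambda>k. real (n k + m k) * p k / (s k)\<^sup>2) \<longlonglongrightarrow> 1"
    and mean: "(\<lambda>k. (real (n k) - real (m k)) * p k / s k) \<longlonglongrightarrow> c"
  shows "weak_conv_m (\<lambda>k. advantage_distr (n k) (m k) (p k) c (s k)) std_normal_distribution"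
proof (rule levy_continuity)
  fix t :: real
  define P where "P k = exp (of_nat (n k) * (of_real (p k) * (iexp (- (t / s k)) - 1))) *
      exp (of_nat (m k) * (of_real (p k) * (iexp (t / s k) - 1)))" for k
  \<comment> \<open>\<open>C\<close> and \<open>D\<close> are the real and imaginary parts of the
    exponent in the Poisson approximation, factored so that \<open>var\<close> and
    \<open>mean\<close> meet the limits of cosine and sine. The shift by \<open>c\<close> makes
    \<open>D\<close> vanish in the limit.\<close>
  define C where "C k = (real (n k + m k) * p k / (s k)\<^sup>2) * ((s k)\<^sup>2 * (cos (t / s k) - 1))" for k
  define D where "D k = t * c - ((real (n k) - real (m k)) * p k / s k) * (s k * sin (t / s k))" for k
  have C: "C \<longlonglongrightarrow> 1 * - (t * t / 2)"
    unfolding C_def by (intro tendsto_mult var filterlim_compose[OF tendsto_one_minus_cos s])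
  have D: "D \<longlonglongrightarrow> t * c - c * t"
    unfolding D_def by (intro tendsto_intros mean filterlim_compose[OF tendsto_mult_sin s])
  have "(\<lambda>k. exp (complex_of_real (C k) + \<i> * of_real (D k))) \<longlonglongrightarrow>
      exp (complex_of_real (1 * - (t * t / 2)) + \<i> * of_real (t * c - c * t))"
    using C D by (intro tendsto_intros)
  also have "exp (complex_of_real (1 * - (t * t / 2)) + \<i> * of_real (t * c - c * t)) = char std_normal_distribution t"
    by (simp add: char_std_normal_distribution exp_of_real[symmetric] power2_eq_square mult.commute)
  finally have lim1: "(\<lambda>k. exp (complex_of_real (C k) + \<i> * of_real (D k))) \<longlonglongrightarrow> char std_normal_distribution t" .
  have s0: "\<forall>\<^sub>F k in sequentially. s k > 0"
    using s by (simp add: filterlim_at_top_dense)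
  have "\<forall>\<^sub>F k in sequentially. exp (complex_of_real (C k) + \<i> * of_real (D k)) = iexp (t * c) * P k"
    using s0
  proof eventually_elim
    case (elim k)
    have "C k = real (n k + m k) * p k * (cos (t / s k) - 1)"
      and "D k = t * c - (real (n k) - real (m k)) * p k * sin (t / s k)"
      using elim by (simp_all add: C_def D_def)
    moreover have "iexp (t / s k) = of_real (cos (t / s k)) + \<i> * of_real (sin (t / s k))"
      and "iexp (- (t / s k)) = of_real (cos (t / s k)) - \<i> * of_real (sin (t / s k))"
      unfolding exp_Euler cos_of_real sin_of_real by simp_all
    ultimately show ?case
      by (simp only: P_def exp_add[symmetric]) (simp add: algebra_simps)
  qed
  hence lim2: "(\<lambda>k. iexp (t * c) * P k) \<longlonglongrightarrow> char std_normal_distribution t"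
    by (rule Lim_transform_eventually[OF lim1])
  have "\<forall>\<^sub>F k in sequentially. norm (char (advantage_distr (n k) (m k) (p k) c (s k)) t - iexp (t * c) * P k)
      \<le> 4 * exp 2 * (real (n k + m k) * (p k)\<^sup>2)"
    using p
  proof eventually_elim
    case (elim k)
    let ?z = "\<lambda>x. of_real (1 - p k) + of_real (p k) * iexp x"
    have one: "norm (iexp x) = 1" for x
      by simp
    note bnd = norm_exp_power_diff[OF elim one]
    have "norm (char (advantage_distr (n k) (m k) (p k) c (s k)) t - iexp (t * c) * P k) =
        norm (?z (- (t / s k)) ^ n k * ?z (t / s k) ^ m k - P k)"
      by (simp only: char_advantage_distr[OF elim] right_diff_distrib[symmetric] norm_mult one mult_1)
    also have "\<dots> \<le> norm (?z (- (t / s k)) ^ n k - exp (of_nat (n k) * (of_real (p k) * (iexp (- (t / s k)) - 1))))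
        + norm (?z (t / s k) ^ m k - exp (of_nat (m k) * (of_real (p k) * (iexp (t / s k) - 1))))"
      unfolding P_def
    proof (rule norm_mult_diff_le)
      show "norm (?z (- (t / s k)) ^ n k) \<le> 1"
        unfolding norm_power by (intro power_le_one bnd(2)) simp
      show "norm (exp (of_nat (m k) * (of_real (p k) * (iexp (t / s k) - 1)))) \<le> 1"
        unfolding exp_of_nat_mult norm_power by (intro power_le_one bnd(3)) (rule norm_ge_zero)
    qed
    also have "\<dots> \<le> real (n k) * (4 * exp 2 * (p k)\<^sup>2) + real (m k) * (4 * exp 2 * (p k)\<^sup>2)"
      by (intro add_mono bnd(1))
    also have "\<dots> = 4 * exp 2 * (real (n k + m k) * (p k)\<^sup>2)"
      by (simp add: algebra_simps)
    finally show ?case .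
  qed
  moreover have "(\<lambda>k. 4 * exp 2 * (real (n k + m k) * (p k)\<^sup>2)) \<longlonglongrightarrow> 0"
    using tendsto_mult_left[OF small, of "4 * exp 2"] by simp
  ultimately have "(\<lambda>k. char (advantage_distr (n k) (m k) (p k) c (s k)) t - iexp (t * c) * P k) \<longlonglongrightarrow> 0"
    by (rule Lim_null_comparison)
  thus "(\<lambda>k. char (advantage_distr (n k) (m k) (p k) c (s k)) t) \<longlonglongrightarrow> char std_normal_distribution t"
    using lim2 by (rule Lim_transform[rotated])
qed (rule real_distribution_advantage_distr real_dist_normal_dist)+

text \<open>On i <= j the rescaled variable is at least \<open>c\<close>. The strict gap to c' is
  used because the distribution function includes the mass at its argument.\<close>

lemma minority_prob_le_cdf:
  assumes "s > 0" "c' < c"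
  shows "minority_prob n m p \<le> 1 - cdf (advantage_distr n m p c s) c'"
proof -
  interpret A: real_distribution "advantage_distr n m p c s"
    by (rule real_distribution_advantage_distr)
  let ?M = "pair_pmf (binomial_pmf n p) (binomial_pmf m p)"
  let ?f = "\<lambda>z. c - (real (fst z) - real (snd z)) / s"
  have "1 - cdf (advantage_distr n m p c s) c' = 1 - measure_pmf.prob ?M {z. ?f z \<le> c'}"
    by (simp add: cdf_def advantage_distr_def measure_distr vimage_def)
  also have "\<dots> = measure_pmf.prob ?M (- {z. ?f z \<le> c'})"
    using measure_pmf.prob_compl[of "{z. ?f z \<le> c'}" ?M] by (simp add: Compl_eq_Diff_UNIV)
  finally have eq: "1 - cdf (advantage_distr n m p c s) c' = measure_pmf.prob ?M (- {z. ?f z \<le> c'})" .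
  have "\<not> ?f (i, j) \<le> c'" if "i \<le> j" for i j
  proof -
    have "(real i - real j) / s \<le> 0"
      using that assms by (simp add: divide_nonpos_pos)
    thus ?thesis
      using assms by simp
  qed
  hence "{(i, j). i \<le> j} \<subseteq> - {z. ?f z \<le> c'}"
    by auto
  thus ?thesis
    unfolding minority_prob_def eq by (intro measure_pmf.finite_measure_mono) auto
qed

section \<open>The first day from the smallest admissible advantage\<close>

text \<open>K sqrt b is the limiting mean of the normalised advantage, and K >
  \<open>K2_ER b\<close> places it above the quantile of 1 - \<open>r_star b\<close>. A point
  strictly between them leaves room on both sides.\<close>

lemma K2_ER_less_imp_quantile:
  assumes b: "b > 1" and K: "K > K2_ER b"
  obtains c where "c < K * sqrt b" "1 - std_normal_cdf c < r_star b"
proof -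
  have r: "0 < r_star b" "r_star b < 1 / 2"
    using r_star_unique[OF b, of "r_star b"] by auto
  define c0 where "c0 = inv std_normal_cdf (1 - r_star b)"
  have c0: "std_normal_cdf c0 = 1 - r_star b"
    unfolding c0_def using r by (intro std_normal_cdf_inv) auto
  have "c0 < K * sqrt b"
    using K b by (simp add: K2_ER_def c0_def field_simps)
  then obtain c where c: "c0 < c" "c < K * sqrt b"
    using dense by blast
  have "1 - std_normal_cdf c < r_star b"
    using std_normal_cdf_strict_mono[OF c(1)] c0 by simp
  thus ?thesis
    using c(2) that by blast
qed

text \<open>Since the advantage is \<open>N - 2 * card (red N y)\<close>, an advantage of at least
  \<open>K * N / sqrt (ln N)\<close> means at most this many red vertices.\<close>

definition max_red :: "real \<Rightarrow> nat \<Rightarrow> nat" where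
  "max_red K N = nat \<lfloor>(real N - K * real N / sqrt (ln (real N))) / 2\<rfloor>"

text \<open>If t in [0, 1) is the fractional part lost by the floor, the error is 2t - 1: rounding
  contributes 2t, and the vertex itself, which is not its own neighbour, is removed from the blue
  side.\<close>

lemma max_red_bounds:
  "\<forall>\<^sub>F N in sequentially. max_red K N \<le> N - 1 \<and>
     \<bar>real (N - 1 - max_red K N) - real (max_red K N) - K * real N / sqrt (ln (real N))\<bar> \<le> 1"
proof -
  let ?x = "\<lambda>N. (real N - K * real N / sqrt (ln (real N))) / 2"
  have "\<forall>\<^sub>F N in sequentially. ?x N \<ge> 0" "\<forall>\<^sub>F N in sequentially. ?x N \<le> real N - 1"
    by real_asymp+
  thus ?thesis
    using eventually_gt_at_top[of 1]
  proof eventually_elim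
    case (elim N)
    have m: "real (max_red K N) \<le> ?x N" "?x N < real (max_red K N) + 1"
      using elim(1) unfolding max_red_def by linarith+
    have "real (max_red K N) \<le> real (N - 1)"
      using m(1) elim by (simp add: of_nat_diff)
    hence le: "max_red K N \<le> N - 1"
      by (simp only: of_nat_le_iff)
    hence "real (N - 1 - max_red K N) = real N - 1 - real (max_red K N)"
      using elim by (simp add: of_nat_diff)
    moreover have "\<bar>real N - 1 - real (max_red K N) - real (max_red K N) - z\<bar> \<le> 1"
      if "real (max_red K N) \<le> (real N - z) / 2" "(real N - z) / 2 < real (max_red K N) + 1" for z
      using that by (simp add: abs_le_iff field_simps)
    ultimately show ?case
      using le m by simp
  qed
qed

lemma edge_probability_in_unit:
  assumes "b > 0"
  shows "\<forall>\<^sub>F N in sequentially. b * ln (real N) / real N \<in> {0..1}"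
proof -
  have "\<forall>\<^sub>F N in sequentially. b * ln (real N) / real N \<ge> 0" "\<forall>\<^sub>F N in sequentially. b * ln (real N) / real N \<le> 1"
    using assms by real_asymp+
  thus ?thesis
    by eventually_elim auto
qed

lemma minority_prob_max_red:
  assumes b: "b > 1" and K: "K > K2_ER b"
  obtains q where "0 \<le> q" "q < r_star b"
    "\<forall>\<^sub>F N in sequentially. minority_prob (N - 1 - max_red K N) (max_red K N) (b * ln (real N) / real N) \<le> q"
proof -
  obtain c where c: "c < K * sqrt b" "1 - std_normal_cdf c < r_star b"
    using K2_ER_less_imp_quantile[OF b K] .
  define m where "m = max_red K"
  define n where "n N = N - 1 - m N" for N
  define p where "p N = b * ln (real N) / real N" for N
  \<comment> \<open>Asymptotically the standard deviation of the difference of the two counts, whose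
    variance is (N - 1) p (1 - p).\<close>
  define s where "s N = sqrt (b * ln (real N))" for N
  define F where "F N = advantage_distr (n N) (m N) (p N) (K * sqrt b) (s N)" for N
  have sum: "\<forall>\<^sub>F N in sequentially. real (n N + m N) = real N - 1"
    using max_red_bounds[of K] eventually_gt_at_top[of 0]
  proof eventually_elim
    case (elim N)
    hence "n N + m N = N - 1"
      by (simp only: n_def m_def le_add_diff_inverse2)
    thus ?case
      using elim by (simp only: of_nat_diff)
  qed
  have s: "filterlim s at_top sequentially"
    unfolding s_def using b by real_asymp
  have "weak_conv_m F std_normal_distribution"
    unfolding F_def
  proof (rule advantage_distr_clt[OF _ s])
    show "\<forall>\<^sub>F N in sequentially. p N \<in> {0..1}"
      unfolding p_def using b by (intro edge_probability_in_unit) simp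
    have "(\<lambda>N. (real N - 1) * (p N)\<^sup>2) \<longlonglongrightarrow> 0"
      unfolding p_def using b by real_asymp
    thus "(\<lambda>N. real (n N + m N) * (p N)\<^sup>2) \<longlonglongrightarrow> 0"
      by (rule Lim_transform_eventually) (use sum in eventually_elim, simp)
    have "(\<lambda>N. (real N - 1) * p N / (s N)\<^sup>2) \<longlonglongrightarrow> 1"
      unfolding p_def s_def using b by real_asymp (simp add: powr_half_sqrt)
    thus "(\<lambda>N. real (n N + m N) * p N / (s N)\<^sup>2) \<longlonglongrightarrow> 1"
      by (rule Lim_transform_eventually) (use sum in eventually_elim, simp)
    \<comment> \<open>Without rounding the normalised mean would be exactly K sqrt b; the rounding
      error of at most 1 is scaled by p / s, which tends to 0.\<close>
    have "\<forall>\<^sub>F N in sequentially. norm ((real (n N) - real (m N)) * p N / s N - K * sqrt b) \<le> p N / s N"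
      using max_red_bounds[of K] eventually_gt_at_top[of 1]
    proof eventually_elim
      case (elim N)
      define L where "L = ln (real N)"
      have L: "L > 0"
        using elim by (simp add: L_def)
      have "s N = sqrt b * sqrt L" "p N = (sqrt b * sqrt b) * (sqrt L * sqrt L) / real N"
        using b L by (simp_all add: p_def s_def real_sqrt_mult flip: L_def)
      moreover have "sqrt b > 0" "sqrt L > 0" "real N > 0"
        using b L elim by auto
      moreover have "K * M / l * ((a * a) * (l * l) / M) / (a * l) = K * a"
        if "a > 0" "l > 0" "M > 0" for a l M :: real
        using that by (simp add: field_simps)
      ultimately have "K * real N / sqrt L * p N / s N = K * sqrt b"
        by presburger
      hence eq: "(real (n N) - real (m N)) * p N / s N - K * sqrt b =
          (real (n N) - real (m N) - K * real N / sqrt L) * (p N / s N)"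
        by (simp add: algebra_simps diff_divide_distrib)
      have ps: "p N / s N \<ge> 0"
        using b L by (simp add: p_def s_def flip: L_def)
      have "\<bar>real (n N) - real (m N) - K * real N / sqrt L\<bar> \<le> 1"
        using elim by (simp add: n_def m_def L_def)
      hence "\<bar>real (n N) - real (m N) - K * real N / sqrt L\<bar> * (p N / s N) \<le> 1 * (p N / s N)"
        using ps by (rule mult_right_mono)
      thus ?case
        by (simp only: eq real_norm_def abs_mult abs_of_nonneg[OF ps] mult_1)
    qed
    moreover have "(\<lambda>N. p N / s N) \<longlonglongrightarrow> 0"
      unfolding p_def s_def using b by real_asymp
    ultimately have "(\<lambda>N. (real (n N) - real (m N)) * p N / s N - K * sqrt b) \<longlonglongrightarrow> 0"
      by (rule Lim_null_comparison)
    thus "(\<lambda>N. (real (n N) - real (m N)) * p N / s N) \<longlonglongrightarrow> K * sqrt b"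
      by (simp add: LIM_zero_iff)
  qed
  hence "(\<lambda>N. cdf (F N) c) \<longlonglongrightarrow> std_normal_cdf c"
    using isCont_std_normal_cdf unfolding weak_conv_m_def weak_conv_def std_normal_cdf_def by blast
  hence lim: "(\<lambda>N. 1 - cdf (F N) c) \<longlonglongrightarrow> 1 - std_normal_cdf c"
    by (intro tendsto_intros)
  interpret real_distribution std_normal_distribution
    by (rule real_dist_normal_dist)
  \<comment> \<open>The limit itself need not be an upper bound for finite \<open>N\<close>, so
    \<open>q\<close> is taken strictly above it.\<close>
  obtain q where q: "1 - std_normal_cdf c < q" "q < r_star b"
    using dense[OF c(2)] by blast
  have "std_normal_cdf c \<le> 1"
    using cdf_bounded_prob by (simp add: std_normal_cdf_def)
  hence "0 \<le> q"
    using q by linarith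
  have "\<forall>\<^sub>F N in sequentially. s N > 0"
    using s by (simp add: filterlim_at_top_dense)
  with order_tendstoD(2)[OF lim q(1)]
  have "\<forall>\<^sub>F N in sequentially. minority_prob (n N) (m N) (p N) \<le> q"
  proof eventually_elim
    case (elim N)
    thus ?case
      using minority_prob_le_cdf[OF elim(2) c(1), of "n N" "m N" "p N"] by (simp add: F_def)
  qed
  thus ?thesis
    using \<open>0 \<le> q\<close> q that by (simp add: n_def m_def p_def)
qed

section \<open>Consensus after one and two days\<close>

text \<open>sqrt (1 - r) - sqrt r is positive and decreasing on (0, 1/2), and the exponent equals 1
  at \<open>r_star b\<close>.\<close>

lemma chernoff_exponent_gt_1:
  assumes b: "b > 1" and r: "0 < r" "r < r_star b"
  shows "b * (sqrt (1 - r) - sqrt r)\<^sup>2 > 1"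
proof -
  have rs: "r_star b < 1 / 2" "b * (sqrt (1 - r_star b) - sqrt (r_star b))\<^sup>2 = 1"
    using r_star_unique[OF b, of "r_star b"] by auto
  have "sqrt (r_star b) < sqrt (1 - r_star b)" "sqrt (1 - r_star b) < sqrt (1 - r)" "sqrt r < sqrt (r_star b)"
    using rs(1) r by auto
  hence "(sqrt (1 - r_star b) - sqrt (r_star b))\<^sup>2 < (sqrt (1 - r) - sqrt r)\<^sup>2"
    by (intro power_strict_mono) linarith+
  hence "b * (sqrt (1 - r_star b) - sqrt (r_star b))\<^sup>2 < b * (sqrt (1 - r) - sqrt r)\<^sup>2"
    using b by simp
  thus ?thesis
    using rs(2) by simp
qed

text \<open>\<open>s = sqrt (r / (1 - r))\<close> is the optimal parameter of the Chernoff bound.\<close>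

lemma minority_prob_le_powr:
  assumes r: "0 < r" "r < 1 / 2" and p: "b * ln (real N) / real N \<in> {0..1}"
    and m: "m \<le> N - 1" "real m \<le> r * real N" and N: "N > 0"
  shows "minority_prob (N - 1 - m) m (b * ln (real N) / real N) \<le>
    exp 1 * real N powr (- (b * (sqrt (1 - r) - sqrt r)\<^sup>2))"
proof -
  define p where "p = b * ln (real N) / real N"
  define u where "u = sqrt (1 - r)"
  define w where "w = sqrt r"
  define s where "s = w / u"
  have uw: "0 < w" "w < u" "u\<^sup>2 = 1 - r" "w\<^sup>2 = r"
    using r by (auto simp: u_def w_def)
  have s: "0 < s" "s < 1"
    using uw by (auto simp: s_def)
  have "1 / s > 1"
    using s by simp
  \<comment> \<open>Since 1/s > s, the worst case is m = r N, where the optimal \<open>s\<close>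
    makes both (1 - r) s and r / s equal to u w.\<close>
  hence "real m * (1 / s - s) \<le> r * real N * (1 / s - s)"
    using m s \<open>1 / s > 1\<close> by (intro mult_right_mono) linarith+
  moreover have s_r: "(1 - r) * s = u * w"
    using uw(1,2) unfolding s_def uw(3)[symmetric] by (simp add: power2_eq_square)
  moreover have "r * (1 / s) = u * w"
    using uw(1,2) unfolding s_def uw(4)[symmetric] by (simp add: power2_eq_square)
  moreover have "r * s = s - u * w"
    using s_r by (simp add: algebra_simps)
  moreover have "r * real N * (1 / s - s) = real N * (r * (1 / s) - r * s)"
    by (simp add: algebra_simps)
  ultimately have *: "real m * (1 / s - s) \<le> real N * (2 * (u * w) - s)"
    by simp
  have "real (N - 1 - m) = real N - 1 - real m"
    using m N by (simp add: of_nat_diff)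
  hence "real (N - 1 - m) * (s - 1) + real m * (1 / s - 1) = (real N - 1) * (s - 1) + real m * (1 / s - s)"
    by (simp add: algebra_simps)
  also have "\<dots> \<le> (real N - 1) * (s - 1) + real N * (2 * (u * w) - s)"
    using * by simp
  \<comment> \<open>As u^2 + w^2 = 1, the terms linear in \<open>N\<close> form -(u - w)^2. The
    missing self-neighbour costs 1 - s <= 1, which with p <= 1 yields the factor exp 1.\<close>
  also have "\<dots> \<le> 1 - real N * (u - w)\<^sup>2"
    using s uw(3,4) by (simp add: power2_diff algebra_simps)
  finally have "p * (real (N - 1 - m) * (s - 1) + real m * (1 / s - 1)) \<le> p * (1 - real N * (u - w)\<^sup>2)"
    using p by (intro mult_left_mono) (auto simp: p_def)
  also have "\<dots> = p - b * (u - w)\<^sup>2 * ln (real N)"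
    using N by (simp add: p_def field_simps)
  also have "\<dots> \<le> 1 - b * (u - w)\<^sup>2 * ln (real N)"
    using p by (simp add: p_def)
  finally have le: "p * (real (N - 1 - m) * (s - 1) + real m * (1 / s - 1)) \<le> 1 - b * (u - w)\<^sup>2 * ln (real N)" .
  have "minority_prob (N - 1 - m) m p \<le> exp (p * (real (N - 1 - m) * (s - 1) + real m * (1 / s - 1)))"
    using p s by (intro minority_prob_chernoff) (auto simp: p_def)
  also have "\<dots> \<le> exp (1 - b * (u - w)\<^sup>2 * ln (real N))"
    using le by simp
  also have "\<dots> = exp 1 * real N powr (- (b * (u - w)\<^sup>2))"
    using N by (simp add: exp_diff exp_minus powr_def field_simps)
  finally show ?thesis
    by (simp add: p_def u_def w_def)
qed

text \<open>Stated for a single step and uniformly in the configuration, so that it applies both to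
  the initial configuration and to the random one that day 2 starts from.\<close>

lemma one_day:
  assumes b: "b > 1" and r: "0 < r" "r < r_star b"
  obtains \<xi> where "\<xi> > 0" "\<forall>\<^sub>F N in sequentially. \<forall>y \<in> {1..N} \<rightarrow> {-1, 1}.
    real (card (red N y)) \<le> r * real N \<longrightarrow>
    measure_pmf.prob (erdos_renyi N (b * ln (real N) / real N)) {g. red N (majority_step N g y) = {}}
      \<ge> 1 - real N powr (- \<xi>)"
proof -
  \<comment> \<open>The union bound uses up one power of \<open>N\<close>, leaving 2
    \<open>\<xi>\<close>; half of this excess absorbs the constant exp 1.\<close>
  define \<xi> where "\<xi> = (b * (sqrt (1 - r) - sqrt r)\<^sup>2 - 1) / 2"
  have \<xi>: "\<xi> > 0"
    using chernoff_exponent_gt_1[OF b r] by (simp add: \<xi>_def)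
  have exponent: "b * (sqrt (1 - r) - sqrt r)\<^sup>2 = 1 + 2 * \<xi>"
    by (simp add: \<xi>_def field_simps)
  have r2: "r < 1 / 2"
    using r r_star_unique[OF b, of "r_star b"] by auto
  have "\<forall>\<^sub>F N in sequentially. real N * (exp 1 * real N powr (- (1 + 2 * \<xi>))) \<le> real N powr (- \<xi>)"
    using \<xi> by real_asymp
  moreover have "\<forall>\<^sub>F N in sequentially. b * ln (real N) / real N \<in> {0..1}"
    using b by (intro edge_probability_in_unit) simp
  ultimately have "\<forall>\<^sub>F N in sequentially. \<forall>y \<in> {1..N} \<rightarrow> {-1, 1}.
    real (card (red N y)) \<le> r * real N \<longrightarrow>
    measure_pmf.prob (erdos_renyi N (b * ln (real N) / real N)) {g. red N (majority_step N g y) = {}}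
      \<ge> 1 - real N powr (- \<xi>)"
    using eventually_ge_at_top[of 2]
  proof eventually_elim
    case (elim N)
    let ?p = "b * ln (real N) / real N"
    show ?case
    proof (intro ballI impI)
      fix y :: "nat \<Rightarrow> int"
      assume y: "y \<in> {1..N} \<rightarrow> {-1, 1}" and m: "real (card (red N y)) \<le> r * real N"
      have "r * real N \<le> 1 / 2 * real N"
        using r2 by (intro mult_right_mono) auto
      moreover have "real (N - 1) = real N - 1" "real N \<ge> 2"
        using elim by (simp_all add: of_nat_diff)
      ultimately have "real (card (red N y)) \<le> real (N - 1)"
        using m by linarith
      hence m': "card (red N y) \<le> N - 1"
        by (simp only: of_nat_le_iff)
      have "real N * minority_prob (N - 1 - card (red N y)) (card (red N y)) ?p \<le>
          real N * (exp 1 * real N powr (- (1 + 2 * \<xi>)))"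
        unfolding exponent[symmetric] using r r2 m m' elim
        by (intro mult_left_mono minority_prob_le_powr) auto
      also have "\<dots> \<le> real N powr (- \<xi>)"
        by (rule elim)
      finally show "1 - real N powr (- \<xi>) \<le>
          measure_pmf.prob (erdos_renyi N ?p) {g. red N (majority_step N g y) = {}}"
        using prob_no_red_majority_step_ge[OF elim(2) y order_refl m'] by linarith
    qed
  qed
  thus ?thesis
    using \<xi> that by blast
qed

section \<open>Consensus in two days\<close>

lemma two_days:
  assumes b: "b > 1" and K: "K > K2_ER b"
  obtains \<xi> where "\<xi> > 0" "\<forall>\<^sub>F N in sequentially. \<forall>y \<in> {1..N} \<rightarrow> {-1, 1}.
    card (red N y) \<le> max_red K N \<longrightarrow>
    prob_no_red N (b * ln (real N) / real N) y 2 \<ge> 1 - 2 * real N powr (- \<xi>)"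
proof -
  obtain q where q: "0 \<le> q" "q < r_star b"
    and evq: "\<forall>\<^sub>F N in sequentially. minority_prob (N - 1 - max_red K N) (max_red K N) (b * ln (real N) / real N) \<le> q"
    using minority_prob_max_red[OF b K] .
  \<comment> \<open>Half the gap goes to the fluctuation of the red count, so that the red fraction
    after day 1 stays below a constant less than \<open>r_star b\<close>.\<close>
  define \<delta> where "\<delta> = (r_star b - q) / 2"
  have \<delta>: "\<delta> > 0" "q + \<delta> < r_star b"
    using q by (auto simp: \<delta>_def field_simps)
  have "0 < q + \<delta>"
    using q \<delta> by simp
  then obtain \<xi> where \<xi>: "\<xi> > 0"
    and one: "\<forall>\<^sub>F N in sequentially. \<forall>y \<in> {1..N} \<rightarrow> {-1, 1}.
      real (card (red N y)) \<le> (q + \<delta>) * real N \<longrightarrow>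
      measure_pmf.prob (erdos_renyi N (b * ln (real N) / real N)) {g. red N (majority_step N g y) = {}}
        \<ge> 1 - real N powr (- \<xi>)"
    using one_day[OF b _ \<delta>(2)] by blast
  \<comment> \<open>The Chebyshev error is of order log N / N, hence eventually below N^(-1/2); the
    minimum bounds the failure probabilities of both days by the same power.\<close>
  define \<xi>' where "\<xi>' = min \<xi> (1 / 2)"
  have \<xi>': "\<xi>' > 0" "\<xi>' \<le> \<xi>" "\<xi>' \<le> 1 / 2"
    using \<xi> by (auto simp: \<xi>'_def)
  have chebyshev: "\<forall>\<^sub>F N in sequentially. (real N + 4 * (b * ln (real N) / real N) * (real N)\<^sup>2) / (\<delta> * real N)\<^sup>2
      \<le> real N powr (- (1 / 2))"
    using b \<delta> by real_asymp
  have p: "\<forall>\<^sub>F N in sequentially. b * ln (real N) / real N \<in> {0..1}"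
    using b by (intro edge_probability_in_unit) simp
  have "\<forall>\<^sub>F N in sequentially. \<forall>y \<in> {1..N} \<rightarrow> {-1, 1}.
    card (red N y) \<le> max_red K N \<longrightarrow>
    prob_no_red N (b * ln (real N) / real N) y 2 \<ge> 1 - 2 * real N powr (- \<xi>')"
    using evq one chebyshev p max_red_bounds[of K] eventually_gt_at_top[of 1]
  proof eventually_elim
    case (elim N)
    define p where "p = b * ln (real N) / real N"
    show ?case
    proof (intro ballI impI)
      fix y :: "nat \<Rightarrow> int"
      assume y: "y \<in> {1..N} \<rightarrow> {-1, 1}" and m: "card (red N y) \<le> max_red K N"
      define R where "R = (\<lambda>g. real (card (red N (majority_step N g y))))"
      define A where "A = {g. R g < real N * q + \<delta> * real N}"
      define x where "x = real N powr (- \<xi>')"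
      have x: "0 \<le> x" "x \<le> 1" "real N powr (- \<xi>) \<le> x" "real N powr (- (1 / 2)) \<le> x"
        using elim(6) \<xi>' powr_mono[of "- \<xi>'" 0 "real N"] by (auto simp: x_def intro!: powr_mono)
      have "measure_pmf.prob (erdos_renyi N p) {g. R g \<ge> real N * q + \<delta> * real N} \<le>
          (real N + 4 * p * (real N)\<^sup>2) / (\<delta> * real N)\<^sup>2"
        unfolding R_def p_def using elim \<delta>
        by (intro prob_card_red_majority_step_ge[OF _ y m]) auto
      also have "\<dots> \<le> x"
        using elim(3) x(4) by (simp add: p_def)
      finally have "measure_pmf.prob (erdos_renyi N p) {g. R g \<ge> real N * q + \<delta> * real N} \<le> x" .
      moreover have "A = - {g. R g \<ge> real N * q + \<delta> * real N}"
        by (auto simp: A_def)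
      ultimately have A: "measure_pmf.prob (erdos_renyi N p) A \<ge> 1 - x"
        using measure_pmf.prob_compl[of "{g. R g \<ge> real N * q + \<delta> * real N}" "erdos_renyi N p"]
        by (simp add: Compl_eq_Diff_UNIV)
      have "1 - 2 * x \<le> (1 - x) * (1 - x)"
        by (simp add: algebra_simps)
      also have "\<dots> \<le> (1 - x) * measure_pmf.prob (erdos_renyi N p) A"
        using A x by (intro mult_left_mono) auto
      also have "\<dots> \<le> prob_no_red N p y 2"
      proof (rule prob_no_red_2_ge)
        fix g assume "g \<in> A"
        hence "real (card (red N (majority_step N g y))) \<le> (q + \<delta>) * real N"
          by (simp add: A_def R_def algebra_simps)
        hence "1 - real N powr (- \<xi>) \<le> measure_pmf.prob (erdos_renyi N p)
            {g'. red N (majority_step N g' (majority_step N g y)) = {}}"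
          using elim(2) majority_step_range[OF y, of g] by (auto simp: p_def)
        thus "1 - x \<le> measure_pmf.prob (erdos_renyi N p)
            {g'. red N (majority_step N g' (majority_step N g y)) = {}}"
          using x(3) by linarith
      qed (use x in simp)
      finally show "1 - 2 * real N powr (- \<xi>') \<le> prob_no_red N (b * ln (real N) / real N) y 2"
        by (simp add: x_def p_def)
    qed
  qed
  thus ?thesis
    using \<xi>'(1) that by blast
qed

theorem theorem1p4:
  fixes b :: real
  assumes "b > 1"
  shows
    "(\<forall>K > K2_ER b. \<exists>\<xi> > 0. \<forall>\<^sub>F N in sequentially.
        \<forall>y\<^sub>0 \<in> {1..N} \<rightarrow> {-1, 1}.
          real_of_int (advantage N y\<^sub>0) \<ge> K * real N / sqrt (ln (real N)) \<longrightarrow>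
          prob_no_red N (b * ln (real N) / real N) y\<^sub>0 2
            \<ge> 1 - 2 * exp (- ((ln (real N))\<^sup>2)) - 2 * real N powr (- \<xi>)) \<and>
     (\<forall>r. 0 < r \<and> r < r_star b \<longrightarrow> (\<exists>\<xi> > 0. \<forall>\<^sub>F N in sequentially.
        \<forall>y\<^sub>0 \<in> {1..N} \<rightarrow> {-1, 1}.
          real_of_int (advantage N y\<^sub>0) \<ge> (1 - 2 * r) * real N \<longrightarrow>
          prob_no_red N (b * ln (real N) / real N) y\<^sub>0 1
            \<ge> 1 - 2 * real N powr (- \<xi>)))"
proof (intro conjI allI impI)
  fix K assume K: "K > K2_ER b"
  obtain \<xi> where \<xi>: "\<xi> > 0" and ev: "\<forall>\<^sub>F N in sequentially. \<forall>y \<in> {1..N} \<rightarrow> {-1, 1}.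
      card (red N y) \<le> max_red K N \<longrightarrow>
      prob_no_red N (b * ln (real N) / real N) y 2 \<ge> 1 - 2 * real N powr (- \<xi>)"
    using two_days[OF assms K] .
  show "\<exists>\<xi> > 0. \<forall>\<^sub>F N in sequentially. \<forall>y\<^sub>0 \<in> {1..N} \<rightarrow> {-1, 1}.
      real_of_int (advantage N y\<^sub>0) \<ge> K * real N / sqrt (ln (real N)) \<longrightarrow>
      prob_no_red N (b * ln (real N) / real N) y\<^sub>0 2
        \<ge> 1 - 2 * exp (- ((ln (real N))\<^sup>2)) - 2 * real N powr (- \<xi>)"
  proof (intro exI conjI)
    show "\<forall>\<^sub>F N in sequentially. \<forall>y\<^sub>0 \<in> {1..N} \<rightarrow> {-1, 1}.
      real_of_int (advantage N y\<^sub>0) \<ge> K * real N / sqrt (ln (real N)) \<longrightarrow>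
      prob_no_red N (b * ln (real N) / real N) y\<^sub>0 2
        \<ge> 1 - 2 * exp (- ((ln (real N))\<^sup>2)) - 2 * real N powr (- \<xi>)"
      using ev
    proof (eventually_elim, intro ballI impI)
      fix N and y :: "nat \<Rightarrow> int"
      assume *: "\<forall>y \<in> {1..N} \<rightarrow> {-1, 1}. card (red N y) \<le> max_red K N \<longrightarrow>
          prob_no_red N (b * ln (real N) / real N) y 2 \<ge> 1 - 2 * real N powr (- \<xi>)"
        and y: "y \<in> {1..N} \<rightarrow> {-1, 1}"
        and adv: "real_of_int (advantage N y) \<ge> K * real N / sqrt (ln (real N))"
      \<comment> \<open>An integer below a real bound is also below its floor, so rounding in
        \<open>max_red\<close> excludes no admissible configuration.\<close>
      have "card (red N y) \<le> max_red K N"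
        unfolding max_red_def using adv unfolding advantage_conv_red[OF y]
        by (intro le_nat_floor) simp
      hence "prob_no_red N (b * ln (real N) / real N) y 2 \<ge> 1 - 2 * real N powr (- \<xi>)"
        using * y by blast
      moreover have "exp (- ((ln (real N))\<^sup>2)) \<ge> 0"
        by simp
      ultimately show "prob_no_red N (b * ln (real N) / real N) y 2
          \<ge> 1 - 2 * exp (- ((ln (real N))\<^sup>2)) - 2 * real N powr (- \<xi>)"
        by linarith
    qed
  qed (rule \<xi>)
next
  fix r assume r: "0 < r \<and> r < r_star b"
  obtain \<xi> where \<xi>: "\<xi> > 0" and ev: "\<forall>\<^sub>F N in sequentially. \<forall>y \<in> {1..N} \<rightarrow> {-1, 1}.
      real (card (red N y)) \<le> r * real N \<longrightarrow>
      measure_pmf.prob (erdos_renyi N (b * ln (real N) / real N)) {g. red N (majority_step N g y) = {}}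
        \<ge> 1 - real N powr (- \<xi>)"
    using one_day[OF assms] r by blast
  show "\<exists>\<xi> > 0. \<forall>\<^sub>F N in sequentially. \<forall>y\<^sub>0 \<in> {1..N} \<rightarrow> {-1, 1}.
      real_of_int (advantage N y\<^sub>0) \<ge> (1 - 2 * r) * real N \<longrightarrow>
      prob_no_red N (b * ln (real N) / real N) y\<^sub>0 1 \<ge> 1 - 2 * real N powr (- \<xi>)"
  proof (intro exI conjI)
    show "\<forall>\<^sub>F N in sequentially. \<forall>y\<^sub>0 \<in> {1..N} \<rightarrow> {-1, 1}.
      real_of_int (advantage N y\<^sub>0) \<ge> (1 - 2 * r) * real N \<longrightarrow>
      prob_no_red N (b * ln (real N) / real N) y\<^sub>0 1 \<ge> 1 - 2 * real N powr (- \<xi>)"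
      using ev
    proof (eventually_elim, intro ballI impI)
      fix N and y :: "nat \<Rightarrow> int"
      assume *: "\<forall>y \<in> {1..N} \<rightarrow> {-1, 1}. real (card (red N y)) \<le> r * real N \<longrightarrow>
          measure_pmf.prob (erdos_renyi N (b * ln (real N) / real N)) {g. red N (majority_step N g y) = {}}
            \<ge> 1 - real N powr (- \<xi>)"
        and y: "y \<in> {1..N} \<rightarrow> {-1, 1}"
        and adv: "real_of_int (advantage N y) \<ge> (1 - 2 * r) * real N"
      have "real (card (red N y)) \<le> r * real N"
        using adv unfolding advantage_conv_red[OF y] by (simp add: algebra_simps)
      hence "prob_no_red N (b * ln (real N) / real N) y 1 \<ge> 1 - real N powr (- \<xi>)"
        unfolding prob_no_red_1 using * y by blast
      thus "prob_no_red N (b * ln (real N) / real N) y 1 \<ge> 1 - 2 * real N powr (- \<xi>)"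
        using powr_ge_zero[of "real N" "- \<xi>"] by linarith
    qed
  qed (rule \<xi>)
qed

end
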